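(* Let $K\ge 2$. For every $\mu\in\mathbb{R}$, $\sigma>0$, $\xi\in\mathbb{R}$, the copula of the $K$-dimensional Multivariate Generalized Extreme Value distribution with parameters $(\mu,\sigma,\xi)$ has density $$c_K(u_1,\dots,u_K)=\left(\prod_{j=1}^{K-1}\frac{d\log\psi_j}{du_j}(u_j)\right)\frac{d\psi_K}{du_K}(u_K)$$ $$=\left(\prod_{j=1}^{K-1}(-1)^{j-1}\psi_j(u_j)\frac{(\log\psi_j(u_j))^{j-1}}{(j-1)!}\right)^{-1}\left(\frac{(-\log\psi_K(u_K))^{K-1}}{(K-1)!}\right)^{-1}$$ for $(u_1,\dots,u_K)\in(0,1)^K$ such that $u_1>\psi_2(u_2)>\dots>\psi_K(u_K)$, and $c_K(u_1,\dots,u_K)=0$ otherwise, where for each $m\ge 1$, $\psi_m:(0,1)\to(0,1)$ is the increasing function satisfying the implicit equation $$u=\psi_m(u)\sum_{j=0}^{m-1}(-1)^j\frac{(\log\psi_m(u))^j}{j!},\qquad u\in(0,1).$$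
   Context: For parameters $\mu\in\mathbb{R}$, $\sigma>0$, $\xi\in\mathbb{R}$ define $$\Lambda(z)=\Big[1+\xi\,\tfrac{z-\mu}{\sigma}\Big]^{-1/\xi}\ \text{ if }\xi\ne 0 \text{ and } \xi\,\tfrac{z-\mu}{\sigma}>-1,\qquad \Lambda(z)=\exp\big(-\tfrac{z-\mu}{\sigma}\big)\ \text{ if }\xi=0,\ z\in\mathbb{R}.$$ The $K$-dimensional Multivariate Generalized Extreme Value (MGEV) distribution with parameters $(\mu,\sigma,\xi)$ is the probability distribution on $\mathbb{R}^K$ with density $$\tilde g_K(z_1,\dots,z_K)=(-1)^K\exp\{-\Lambda(z_K)\}\prod_{j=1}^K\Lambda'(z_j)\ \text{ if }(z_1,\dots,z_K)\in\Omega_\xi,$$ and $\tilde g_K=0$ otherwise, where $\Omega_0=\{z_1>\dots>z_K\}$, $\Omega_\xi=\{z_1>\dots>z_K>\mu-\frac{\sigma}{\xi}\}$ for $\xi>0$, and $\Omega_\xi=\{\mu-\frac{\sigma}{\xi}>z_1>\dots>z_K\}$ for $\xi<0$. Its $m$-th marginal has distribution function $G_m(z)=\exp\{-\Lambda(z)\}\sum_{j=0}^{m-1}\frac{\Lambda(z)^j}{j!}$ wherever $\Lambda(z)$ is defined (and $0$ below the support, $1$ above it). Since the marginals are continuous, the copula of this distribution is unique: it is the joint distribution function on $[0,1]^K$ of $(G_1(Y_1),\dots,G_K(Y_K))$ when $(Y_1,\dots,Y_K)$ is MGEV distributed. *)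

theory Defs
  imports "HOL-Probability.Probability"
begin

text \<open>
  Vectors in \<open>\<real>\<^sup>K\<close> are functions in the space of the product measure over the index set \<open>{1..K}\<close>,
  that is, functions \<open>nat \<Rightarrow> real\<close> extensional on \<open>{1..K}\<close>.
\<close>

definition marginal_cdf :: "('i \<Rightarrow> real) measure \<Rightarrow> 'i \<Rightarrow> real \<Rightarrow> real" where
  "marginal_cdf M j = cdf (distr M borel (\<lambda>y. y j))"

text \<open>
  The copula of a distribution \<open>M\<close> on \<open>\<real>\<^sup>I\<close> with continuous marginals: the joint distribution
  function of the vector of the \<open>marginal_cdf M j (Y j)\<close>, where \<open>Y\<close> has law \<open>M\<close>.
\<close>

definition copula :: "'i set \<Rightarrow> ('i \<Rightarrow> real) measure \<Rightarrow> ('i \<Rightarrow> real) \<Rightarrow> real" where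
  "copula I M u = measure M {y \<in> space M. \<forall>j\<in>I. marginal_cdf M j (y j) \<le> u j}"

text \<open>A copula is a distribution function on the unit cube, so only boxes inside the cube matter.\<close>

definition has_copula_density ::
  "'i set \<Rightarrow> (('i \<Rightarrow> real) \<Rightarrow> real) \<Rightarrow> (('i \<Rightarrow> real) \<Rightarrow> real) \<Rightarrow> bool" where
  "has_copula_density I C c \<longleftrightarrow>
     c \<in> borel_measurable (PiM I (\<lambda>_. lborel)) \<and>
     (\<forall>x\<in>space (PiM I (\<lambda>_. lborel)). 0 \<le> c x) \<and>
     (\<forall>u \<in> I \<rightarrow>\<^sub>E {0..1}.
        ennreal (C u) = (\<integral>\<^sup>+x \<in> (\<Pi>\<^sub>E j\<in>I. {0..u j}). ennreal (c x) \<partial>(PiM I (\<lambda>_. lborel))))"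

text \<open>
  For \<open>\<xi> \<noteq> 0\<close> only the values at points with \<open>\<xi> * ((z - \<mu>) / \<sigma>) > -1\<close> are meaningful. This set is
  open and contains all coordinates of points of \<open>mgev_support\<close>, so that neither these values nor
  the derivatives used below depend on the convention elsewhere.
\<close>

definition mgev_Lambda :: "real \<Rightarrow> real \<Rightarrow> real \<Rightarrow> real \<Rightarrow> real" where
  "mgev_Lambda \<mu> \<sigma> \<xi> z =
     (if \<xi> = 0 then exp (- ((z - \<mu>) / \<sigma>)) else (1 + \<xi> * ((z - \<mu>) / \<sigma>)) powr (- 1 / \<xi>))"

definition mgev_support :: "nat \<Rightarrow> real \<Rightarrow> real \<Rightarrow> real \<Rightarrow> (nat \<Rightarrow> real) set" where
  "mgev_support K \<mu> \<sigma> \<xi> =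
     {z. (\<forall>j\<in>{1..<K}. z j > z (j + 1)) \<and>
         (\<xi> > 0 \<longrightarrow> z K > \<mu> - \<sigma> / \<xi>) \<and>
         (\<xi> < 0 \<longrightarrow> \<mu> - \<sigma> / \<xi> > z 1)}"

definition mgev_density :: "nat \<Rightarrow> real \<Rightarrow> real \<Rightarrow> real \<Rightarrow> (nat \<Rightarrow> real) \<Rightarrow> real" where
  "mgev_density K \<mu> \<sigma> \<xi> z =
     (if z \<in> mgev_support K \<mu> \<sigma> \<xi>
      then (-1) ^ K * exp (- mgev_Lambda \<mu> \<sigma> \<xi> (z K)) * (\<Prod>j=1..K. deriv (mgev_Lambda \<mu> \<sigma> \<xi>) (z j))
      else 0)"

definition mgev :: "nat \<Rightarrow> real \<Rightarrow> real \<Rightarrow> real \<Rightarrow> (nat \<Rightarrow> real) measure" where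
  "mgev K \<mu> \<sigma> \<xi> =
     density (PiM {1..K} (\<lambda>_. lborel)) (\<lambda>z. ennreal (mgev_density K \<mu> \<sigma> \<xi> z))"

text \<open>
  The implicit function is taken extensional on \<open>{0<..<1}\<close>, so that it can be unique as a HOL
  function.
\<close>

definition is_psi :: "nat \<Rightarrow> (real \<Rightarrow> real) \<Rightarrow> bool" where
  "is_psi m f \<longleftrightarrow>
     f \<in> {0<..<1} \<rightarrow>\<^sub>E {0<..<1} \<and>
     strict_mono_on {0<..<1} f \<and>
     (\<forall>u\<in>{0<..<1}. u = f u * (\<Sum>j=0..m-1. (-1) ^ j * (ln (f u)) ^ j / fact j))"

definition psi :: "nat \<Rightarrow> real \<Rightarrow> real" where
  "psi m = (THE f. is_psi m f)"

definition mgev_copula_region :: "nat \<Rightarrow> (nat \<Rightarrow> real) set" where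
  "mgev_copula_region K =
     {u \<in> {1..K} \<rightarrow>\<^sub>E {0<..<1}.
        u 1 > psi 2 (u 2) \<and> (\<forall>j\<in>{2..<K}. psi j (u j) > psi (j + 1) (u (j + 1)))}"

definition mgev_copula_density :: "nat \<Rightarrow> (nat \<Rightarrow> real) \<Rightarrow> real" where
  "mgev_copula_density K u =
     (if u \<in> mgev_copula_region K
      then (\<Prod>j=1..K-1. deriv (\<lambda>t. ln (psi j t)) (u j)) * deriv (psi K) (u K)
      else 0)"

end

theory Submission
  imports Defs
begin

text \<open>
  Let \<open>Y\<close> be MGEV distributed and put \<open>W\<^sub>j = exp (- \<Lambda>(Y\<^sub>j))\<close>. Because \<open>- \<Lambda>' = w' / w\<close> for \<open>w = exp (- \<Lambda>)\<close>,
  the vector \<open>W\<close> has density \<open>\<Prod>\<^bsub>j<K\<^esub> 1 / w\<^sub>j\<close> on \<open>1 > w\<^sub>1 > \<dots> > w\<^sub>K > 0\<close>, whatever the parameters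
  are (\<open>distr_mgev\<close>). This is the joint density of the partial products
  \<open>V\<^sub>1, V\<^sub>1 * V\<^sub>2, \<dots>, V\<^sub>1 * \<dots> * V\<^sub>K\<close> of independent uniform variables: given \<open>w\<^sub>j\<close>, the next
  coordinate is uniform on \<open>(0, w\<^sub>j)\<close>. The \<open>m\<close>-th coordinate therefore has distribution function
  \<open>P\<^sub>m(w) = w * (\<Sum>j<m. (- ln w)^j / j!)\<close> and density \<open>p\<^sub>m(w) = (- ln w)^(m-1) / (m-1)!\<close>
  (\<open>nn_integral_shrink_chain_component\<close>). The implicit equation for \<open>psi m\<close> says exactly that \<open>psi m\<close>
  is the inverse of the bijection \<open>P\<^sub>m\<close> of the unit interval, which settles existence, uniqueness and
  differentiability.
  
  The \<open>m\<close>-th marginal distribution function of \<open>Y\<close> is \<open>P\<^sub>m\<close> composed with \<open>exp (- \<Lambda>)\<close>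
  (\<open>marginal_cdf_mgev\<close>), so the copula is the law of \<open>(P\<^sub>1(W\<^sub>1), \<dots>, P\<^sub>K(W\<^sub>K))\<close>. Substituting
  \<open>w\<^sub>j = psi j (u\<^sub>j)\<close>, \<open>dw\<^sub>j = du\<^sub>j / p\<^sub>j(w\<^sub>j)\<close> in the density of \<open>W\<close> gives
  \<open>\<Prod>\<^bsub>j<K\<^esub> 1 / (w\<^sub>j * p\<^sub>j(w\<^sub>j)) * 1 / p\<^sub>K(w\<^sub>K)\<close>, which is the asserted copula density.
  
  Both substitutions act on each coordinate separately. They are instances of the transport principle
  \<open>distr_density_PiM\<close> for product measures, whose one-dimensional input is the probability integral
  transform \<open>distr_derivative_uniform01\<close>.
\<close>

section \<open>Coordinatewise transport of densities on product spaces\<close>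

lemma emeasure_distr_density:
  assumes [measurable]: "f \<in> borel_measurable M" "H \<in> M \<rightarrow>\<^sub>M N" "A \<in> sets N"
  shows "emeasure (distr (density M f) N H) A = (\<integral>\<^sup>+x. f x * indicator A (H x) \<partial>M)"
proof -
  have "emeasure (distr (density M f) N H) A = (\<integral>\<^sup>+x. indicator A x \<partial>distr (density M f) N H)"
    by simp
  also have "\<dots> = (\<integral>\<^sup>+x. indicator A (H x) \<partial>density M f)"
    by (rule nn_integral_distr) simp_all
  also have "\<dots> = (\<integral>\<^sup>+x. f x * indicator A (H x) \<partial>M)"
    by (rule nn_integral_density) simp_all
  finally show ?thesis .
qed

text \<open>
  On a box the left-hand side with \<open>c = 1\<close> factors into one-dimensional integrals, so a map that acts
  on each coordinate separately is handled by one-dimensional substitution alone. A further density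
  \<open>c\<close>, which may couple the coordinates, passes through any image measure. This carries both changes
  of variables of the proof.
\<close>

lemma distr_density_PiM:
  fixes h :: "'i \<Rightarrow> 'a \<Rightarrow> ennreal"
  assumes "product_sigma_finite M" "product_sigma_finite N" and fin: "finite I"
    and H [measurable]: "\<And>i. i \<in> I \<Longrightarrow> H i \<in> M i \<rightarrow>\<^sub>M N i"
    and h [measurable]: "\<And>i. i \<in> I \<Longrightarrow> h i \<in> borel_measurable (M i)"
    and transport: "\<And>i. i \<in> I \<Longrightarrow> distr (density (M i) (h i)) (N i) (H i) = N i"
    and c [measurable]: "c \<in> borel_measurable (PiM I N)"
  shows "distr (density (PiM I M) (\<lambda>y. (\<Prod>i\<in>I. h i (y i)) * c (\<lambda>i\<in>I. H i (y i)))) (PiM I N)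
      (\<lambda>y. \<lambda>i\<in>I. H i (y i)) = density (PiM I N) c"
proof -
  interpret M: product_sigma_finite M by fact
  interpret N: product_sigma_finite N by fact
  let ?H = "\<lambda>y. \<lambda>i\<in>I. H i (y i)" and ?h = "\<lambda>y. \<Prod>i\<in>I. h i (y i)"
  have H_meas [measurable]: "?H \<in> PiM I M \<rightarrow>\<^sub>M PiM I N"
    by measurable
  have h_meas [measurable]: "?h \<in> borel_measurable (PiM I M)"
    by measurable
  have base: "distr (density (PiM I M) ?h) (PiM I N) ?H = PiM I N"
  proof (rule N.PiM_eqI [OF fin])
    fix A assume A: "\<And>i. i \<in> I \<Longrightarrow> A i \<in> sets (N i)"
    have box [measurable]: "Pi\<^sub>E I A \<in> sets (PiM I N)"
      using A fin by (intro sets_PiM_I_finite) auto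
    have "emeasure (distr (density (PiM I M) ?h) (PiM I N) ?H) (Pi\<^sub>E I A)
        = (\<integral>\<^sup>+y. ?h y * indicator (Pi\<^sub>E I A) (?H y) \<partial>PiM I M)"
      by (rule emeasure_distr_density) measurable
    also have "\<dots> = (\<integral>\<^sup>+y. (\<Prod>i\<in>I. h i (y i) * indicator (A i) (H i (y i))) \<partial>PiM I M)"
    proof (rule nn_integral_cong)
      fix y
      have "indicator (Pi\<^sub>E I A) (?H y) = (\<Prod>i\<in>I. indicator (A i) (H i (y i)) :: ennreal)"
        using fin by (auto simp: indicator_def PiE_iff prod_zero_iff)
      then show "?h y * indicator (Pi\<^sub>E I A) (?H y) = (\<Prod>i\<in>I. h i (y i) * indicator (A i) (H i (y i)))"
        by (simp add: prod.distrib)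
    qed
    also have "\<dots> = (\<Prod>i\<in>I. \<integral>\<^sup>+t. h i t * indicator (A i) (H i t) \<partial>M i)"
      using A
      by (intro M.product_nn_integral_prod fin borel_measurable_times_ennreal h 
          measurable_compose [OF H borel_measurable_indicator]) auto
    also have "\<dots> = (\<Prod>i\<in>I. emeasure (N i) (A i))"
    proof (rule prod.cong [OF refl])
      fix i assume i [measurable]: "i \<in> I"
      have [measurable]: "A i \<in> sets (N i)" using A i .
      have "emeasure (N i) (A i) = emeasure (distr (density (M i) (h i)) (N i) (H i)) (A i)"
        using transport [OF i] by simp
      also have "\<dots> = (\<integral>\<^sup>+t. h i t * indicator (A i) (H i t) \<partial>M i)"
        by (rule emeasure_distr_density) measurable
      finally show "(\<integral>\<^sup>+t. h i t * indicator (A i) (H i t) \<partial>M i) = emeasure (N i) (A i)" ..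
    qed
    finally show "emeasure (distr (density (PiM I M) ?h) (PiM I N) ?H) (Pi\<^sub>E I A)
        = (\<Prod>i\<in>I. emeasure (N i) (A i))" .
  qed simp
  have "density (PiM I N) c = density (distr (density (PiM I M) ?h) (PiM I N) ?H) c"
    by (simp add: base)
  also have "\<dots> = distr (density (density (PiM I M) ?h) (\<lambda>y. c (?H y))) (PiM I N) ?H"
    by (rule density_distr) measurable
  also have "density (density (PiM I M) ?h) (\<lambda>y. c (?H y)) = density (PiM I M) (\<lambda>y. ?h y * c (?H y))"
    by (rule density_density_eq) measurable
  finally show ?thesis ..
qed

section \<open>The uniform distribution on the unit interval\<close>

definition uniform01 :: "real measure" where
  "uniform01 = density lborel (indicator {0<..<1})"

lemma sets_uniform01 [simp, measurable_cong]: "sets uniform01 = sets borel"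
  by (simp add: uniform01_def)

lemma space_uniform01 [simp]: "space uniform01 = UNIV"
  by (simp add: uniform01_def)

lemma nn_integral_uniform01:
  "f \<in> borel_measurable borel \<Longrightarrow>
    (\<integral>\<^sup>+x. f x \<partial>uniform01) = (\<integral>\<^sup>+x. f x * indicator {0<..<1} x \<partial>lborel)"
  by (simp add: uniform01_def nn_integral_density mult.commute)

lemma emeasure_uniform01: "A \<in> sets borel \<Longrightarrow> emeasure uniform01 A = emeasure lborel (A \<inter> {0<..<1})"
  by (simp add: uniform01_def emeasure_density Int_commute flip: indicator_inter_arith)

lemma prob_space_uniform01: "prob_space uniform01"
  by standard (simp add: emeasure_uniform01)

lemma AE_uniform01: "AE x in uniform01. x \<in> {0<..<1}"
  unfolding uniform01_def by (subst AE_density) (simp_all add: indicator_def)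

lemma product_sigma_finite_uniform01: "product_sigma_finite (\<lambda>_. uniform01)"
  by (simp add: product_sigma_finite.intro prob_space_imp_sigma_finite prob_space_uniform01)

lemma product_sigma_finite_lborel: "product_sigma_finite (\<lambda>_. lborel :: real measure)"
  by (simp add: product_sigma_finite.intro sigma_finite_lborel)

text \<open>
  The probability integral transform. Stating it through a bijection \<open>H\<close> and its derivative, instead of
  a distribution function and its limits at the ends of the support, lets the change of variables
  formula for Lebesgue integrals do the work, applied to the indicator of an arbitrary Borel set.
\<close>

lemma distr_derivative_uniform01:
  fixes H h :: "real \<Rightarrow> real"
  assumes S [measurable]: "S \<in> sets borel" and H [measurable]: "H \<in> borel_measurable borel"
    and h [measurable]: "h \<in> borel_measurable borel"
    and bij: "bij_betw H S {0<..<1}"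
    and deriv: "\<And>x. x \<in> S \<Longrightarrow> (H has_real_derivative h x) (at x)"
    and nonneg: "\<And>x. x \<in> S \<Longrightarrow> 0 \<le> h x"
  shows "distr (density lborel (\<lambda>x. indicator S x * ennreal (h x))) uniform01 H = uniform01"
proof (rule measure_eqI)
  fix A assume "A \<in> sets (distr (density lborel (\<lambda>x. indicator S x * ennreal (h x))) uniform01 H)"
  then have A [measurable]: "A \<in> sets borel" by simp
  have image: "H ` S = {0<..<1}" and inj: "inj_on H S"
    using bij by (simp_all add: bij_betw_def)
  let ?f = "indicator A :: real \<Rightarrow> real"
  let ?V = "measure lborel (A \<inter> {0<..<1})"
  have fin: "emeasure lborel (A \<inter> {0<..<1}) < \<infinity>"
    using emeasure_mono [of "A \<inter> {0<..<1::real}" "{0<..<1}" lborel] by (simp add: order_le_less_trans)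
  have "(?f has_integral ?V) {0<..<1}"
  proof -
    have "((\<lambda>x. 1 :: real) has_integral ?V) (A \<inter> {0<..<1})"
      using fin by (intro has_integral_measure_lborel) simp_all
    then have "((\<lambda>x. if x \<in> A then 1 else 0 :: real) has_integral ?V) {0<..<1}"
      by (simp only: has_integral_restrict_Int Int_commute)
    then show ?thesis by (simp add: indicator_def [abs_def] of_bool_def)
  qed
  then have "?f absolutely_integrable_on H ` S \<and> integral (H ` S) ?f = ?V"
    unfolding image by (auto intro!: nonnegative_absolutely_integrable_1 simp: integral_unique has_integral_integrable)
  then have "(\<lambda>x. \<bar>h x\<bar> * ?f (H x)) absolutely_integrable_on S \<and>
      integral S (\<lambda>x. \<bar>h x\<bar> * ?f (H x)) = ?V"
    using has_absolute_integral_change_of_variables_1' [of S H h ?f ?V] inj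
      has_field_derivative_at_within [OF deriv] by simp
  then have "((\<lambda>x. \<bar>h x\<bar> * ?f (H x)) has_integral ?V) S"
    using absolutely_integrable_on_def has_integral_integral by metis
  then have "ennreal ?V = (\<integral>\<^sup>+x. ennreal (indicator S x * (\<bar>h x\<bar> * ?f (H x))) \<partial>lborel)"
    by (intro nn_integral_has_integral_lebesgue [symmetric]) auto
  also have "(\<integral>\<^sup>+x. ennreal (indicator S x * (\<bar>h x\<bar> * ?f (H x))) \<partial>lborel)
      = (\<integral>\<^sup>+x. (indicator S x * ennreal (h x)) * indicator A (H x) \<partial>lborel)"
    using nonneg by (intro nn_integral_cong) (auto simp: indicator_def)
  also have "\<dots> = emeasure (distr (density lborel (\<lambda>x. indicator S x * ennreal (h x))) uniform01 H) A"
    by (rule emeasure_distr_density [symmetric]) simp_all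
  finally have "ennreal ?V = emeasure (distr (density lborel (\<lambda>x. indicator S x * ennreal (h x))) uniform01 H) A" .
  moreover have "ennreal ?V = emeasure uniform01 A"
    using fin by (subst emeasure_uniform01) (auto simp: emeasure_eq_ennreal_measure)
  ultimately show "emeasure (distr (density lborel (\<lambda>x. indicator S x * ennreal (h x))) uniform01 H) A
      = emeasure uniform01 A" by simp
qed simp

section \<open>Products of independent uniform variables and their quantile functions\<close>

text \<open>
  The distribution function and the density of \<open>V\<^sub>1 * \<dots> * V\<^sub>m\<close> for independent uniform \<open>V\<^sub>i\<close>: the
  variable \<open>- ln (V\<^sub>1 * \<dots> * V\<^sub>m)\<close> is a sum of \<open>m\<close> standard exponentials, hence Gamma distributed. The
  truncated \<open>m - 1\<close> makes the index \<open>0\<close> a copy of the index \<open>1\<close>.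
\<close>

definition uniform_product_cdf :: "nat \<Rightarrow> real \<Rightarrow> real" where
  "uniform_product_cdf m w = w * (\<Sum>j=0..m-1. (-1) ^ j * ln w ^ j / fact j)"

definition uniform_product_density :: "nat \<Rightarrow> real \<Rightarrow> real" where
  "uniform_product_density m w = (- ln w) ^ (m - 1) / fact (m - 1)"

lemma measurable_uniform_product_cdf [measurable]:
  "uniform_product_cdf m \<in> borel_measurable borel"
  unfolding uniform_product_cdf_def [abs_def] by measurable

lemma measurable_uniform_product_density [measurable]:
  "uniform_product_density m \<in> borel_measurable borel"
  unfolding uniform_product_density_def [abs_def] by measurable

lemma uniform_product_density_pos: "w \<in> {0<..<1} \<Longrightarrow> 0 < uniform_product_density m w"
  by (simp add: uniform_product_density_def)

lemma DERIV_uniform_product_cdf: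
  assumes "0 < w"
  shows "(uniform_product_cdf m has_real_derivative uniform_product_density m w) (at w)"
proof -
  have "((\<lambda>w. w * (\<Sum>j=0..n. (-1) ^ j * ln w ^ j / fact j)) has_real_derivative (- ln w) ^ n / fact n) (at w)"
    for n
  proof (induction n)
    case 0
    then show ?case by (auto intro!: derivative_eq_intros)
  next
    case (Suc n)
    have "((\<lambda>w. w * ((-1) ^ Suc n * ln w ^ Suc n / fact (Suc n))) has_real_derivative
        (- ln w) ^ Suc n / fact (Suc n) - (- ln w) ^ n / fact n) (at w)"
      using assms
      by (auto intro!: derivative_eq_intros simp del: power_Suc fact_Suc)
        (simp add: power_minus [of "ln w"] divide_simps)
    \<comment> \<open>The derivatives of the summands telescope.\<close>
    from DERIV_add [OF Suc this] show ?case
      by (simp add: distrib_left del: power_Suc fact_Suc)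
  qed
  then show ?thesis
    by (simp add: uniform_product_cdf_def [abs_def] uniform_product_density_def)
qed

lemma uniform_product_cdf_strict_mono: "strict_mono_on {0<..1} (uniform_product_cdf m)"
proof (rule strict_mono_onI)
  fix v w :: real assume vw: "v \<in> {0<..1}" "w \<in> {0<..1}" "v < w"
  show "uniform_product_cdf m v < uniform_product_cdf m w"
  proof (rule DERIV_pos_imp_increasing_open [OF \<open>v < w\<close>])
    show "continuous_on {v..w} (uniform_product_cdf m)"
      using vw by (intro continuous_at_imp_continuous_on ballI DERIV_isCont [OF DERIV_uniform_product_cdf]) auto
    fix x assume "v < x" "x < w"
    then have "x \<in> {0<..<1}" using vw by simp
    then show "\<exists>d. (uniform_product_cdf m has_real_derivative d) (at x) \<and> 0 < d"
      using DERIV_uniform_product_cdf [of x m] uniform_product_density_pos [of x m] by auto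
  qed
qed

text \<open>
  Monotonicity gives injectivity, and surjectivity is the intermediate value theorem: the value at \<open>1\<close>
  is \<open>1\<close>, and the limit at \<open>0\<close> is \<open>0\<close> because \<open>x\<^sup>j / exp x\<close> tends to \<open>0\<close> after substituting
  \<open>w = exp (- x)\<close>.
\<close>

lemma bij_betw_uniform_product_cdf: "bij_betw (uniform_product_cdf m) {0<..<1} {0<..<1}"
proof (rule bij_betw_imageI)
  let ?P = "uniform_product_cdf m"
  have mono: "?P v < ?P w" if "0 < v" "v < w" "w \<le> 1" for v w
    using uniform_product_cdf_strict_mono [of m] that by (auto simp: strict_mono_on_def)
  have one: "?P 1 = 1"
    by (simp add: uniform_product_cdf_def sum.atLeast_Suc_atMost)
  have alt: "?P w = w * (\<Sum>j=0..m-1. (- ln w) ^ j / fact j)" for w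
    by (simp add: uniform_product_cdf_def power_minus [of "ln w"])
  have pos: "0 < ?P w" if "0 < w" "w < 1" for w
    unfolding alt using that
    by (intro mult_pos_pos sum_pos2 [of _ 0]) (auto intro!: divide_nonneg_pos zero_le_power)
  show "inj_on ?P {0<..<1}"
    using strict_mono_on_imp_inj_on [OF uniform_product_cdf_strict_mono] by (rule inj_on_subset) auto
  have "((\<lambda>x::real. \<Sum>j=0..m-1. x ^ j / exp x / fact j) \<longlongrightarrow> (\<Sum>j=0..m-1. 0 / fact j)) at_top"
    by (intro tendsto_sum tendsto_divide tendsto_power_div_exp_0 tendsto_const) auto
  also have "(\<lambda>x::real. \<Sum>j=0..m-1. x ^ j / exp x / fact j) = (\<lambda>x. ?P (exp (- x)))"
    unfolding alt ln_exp sum_distrib_left by (simp add: exp_minus field_simps)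
  finally have lim: "((\<lambda>x. ?P (exp (- x))) \<longlongrightarrow> 0) at_top"
    by simp
  show "?P ` {0<..<1} = {0<..<1}"
  proof (intro equalityI subsetI)
    fix u assume "u \<in> ?P ` {0<..<1}"
    then show "u \<in> {0<..<1}"
      using pos mono [of _ 1] one by auto
  next
    fix u :: real assume u: "u \<in> {0<..<1}"
    have "eventually (\<lambda>x. 0 < x \<and> ?P (exp (- x)) < u) at_top"
      using order_tendstoD(2) [OF lim] u by (intro eventually_conj eventually_gt_at_top) auto
    then obtain x where x: "0 < x" "?P (exp (- x)) < u"
      by (auto simp: eventually_at_top_linorder)
    have "continuous_on {exp (- x)..1} ?P"
      by (intro continuous_at_imp_continuous_on ballI DERIV_isCont [OF DERIV_uniform_product_cdf])
        (auto intro: order_less_le_trans [OF exp_gt_zero])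
    then obtain w where w: "exp (- x) \<le> w" "w \<le> 1" "?P w = u"
      using IVT' [of ?P "exp (- x)" u 1] x u one by auto
    then have "0 < w" "w \<noteq> 1"
      using u one by (auto intro: order_less_le_trans [OF exp_gt_zero])
    then show "u \<in> ?P ` {0<..<1}"
      using w by auto
  qed
qed

lemma distr_uniform_product_cdf:
  "distr (density uniform01 (\<lambda>w. ennreal (uniform_product_density m w))) uniform01 (uniform_product_cdf m)
    = uniform01"
proof -
  have "density uniform01 (\<lambda>w. ennreal (uniform_product_density m w))
      = density lborel (\<lambda>w. indicator {0<..<1} w * ennreal (uniform_product_density m w))"
    unfolding uniform01_def by (rule density_density_eq) measurable
  then show ?thesis
    using distr_derivative_uniform01 [OF _ _ _ bij_betw_uniform_product_cdf DERIV_uniform_product_cdf]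
    by (simp add: uniform_product_density_pos less_imp_le)
qed

text \<open>
  The implicit equation says that \<open>psi m\<close> is the quantile function of the product of \<open>m\<close> uniform
  variables.
\<close>

lemma is_psi_iff:
  "is_psi m f \<longleftrightarrow> f \<in> {0<..<1} \<rightarrow>\<^sub>E {0<..<1} \<and> strict_mono_on {0<..<1} f \<and>
    (\<forall>u\<in>{0<..<1}. uniform_product_cdf m (f u) = u)"
  unfolding is_psi_def uniform_product_cdf_def
  by (simp only: eq_commute [of _ "f _ * _"])

lemma ex1_is_psi: "\<exists>!f. is_psi m f"
proof -
  let ?I = "{0<..<1::real}"
  note bij = bij_betw_uniform_product_cdf [of m]
  define f where "f = restrict (inv_into ?I (uniform_product_cdf m)) ?I"
  have f_in: "f u \<in> ?I" and Pf: "uniform_product_cdf m (f u) = u" if "u \<in> ?I" for u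
    using that bij_betw_apply [OF bij_betw_inv_into [OF bij]] bij_betw_inv_into_right [OF bij]
    by (simp_all add: f_def del: greaterThanLessThan_iff)
  have "strict_mono_on ?I f"
  proof (rule strict_mono_onI)
    fix u v assume uv: "u \<in> ?I" "v \<in> ?I" "u < v"
    show "f u < f v"
    proof (rule ccontr)
      assume "\<not> f u < f v"
      then have "uniform_product_cdf m (f v) \<le> uniform_product_cdf m (f u)"
        using strict_mono_on_leD [OF uniform_product_cdf_strict_mono, of "f v" "f u" m]
          f_in [OF uv(1)] f_in [OF uv(2)] by auto
      then show False using Pf uv by auto
    qed
  qed
  then have "is_psi m f"
    unfolding is_psi_iff using f_in Pf by (auto simp: f_def)
  moreover have "g = f" if "is_psi m g" for g
  proof (rule PiE_ext [of _ ?I "\<lambda>_. ?I"])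
    show "g \<in> ?I \<rightarrow>\<^sub>E ?I" "f \<in> ?I \<rightarrow>\<^sub>E ?I"
      using that \<open>is_psi m f\<close> by (auto simp: is_psi_iff)
    fix u assume u: "u \<in> ?I"
    then have "uniform_product_cdf m (g u) = uniform_product_cdf m (f u)" "g u \<in> ?I"
      using that Pf by (auto simp: is_psi_iff)
    then show "g u = f u"
      using inj_onD [OF bij_betw_imp_inj_on [OF bij]] f_in u by auto
  qed
  ultimately show ?thesis by blast
qed

lemma is_psi_psi: "is_psi m (psi m)"
  unfolding psi_def by (rule theI' [OF ex1_is_psi])

lemma psi_mem: "u \<in> {0<..<1} \<Longrightarrow> psi m u \<in> {0<..<1}"
  using is_psi_psi [of m] unfolding is_psi_iff by (blast dest: PiE_mem)

lemma uniform_product_cdf_psi: "u \<in> {0<..<1} \<Longrightarrow> uniform_product_cdf m (psi m u) = u"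
  using is_psi_psi [of m] unfolding is_psi_iff by blast

lemma uniform_product_cdf_mem: "w \<in> {0<..<1} \<Longrightarrow> uniform_product_cdf m w \<in> {0<..<1}"
  by (rule bij_betw_apply [OF bij_betw_uniform_product_cdf])

lemma psi_uniform_product_cdf:
  assumes "w \<in> {0<..<1}"
  shows "psi m (uniform_product_cdf m w) = w"
proof (rule inj_onD [OF bij_betw_imp_inj_on [OF bij_betw_uniform_product_cdf [of m]]])
  note P = uniform_product_cdf_mem [OF assms, of m]
  show "uniform_product_cdf m (psi m (uniform_product_cdf m w)) = uniform_product_cdf m w"
    by (rule uniform_product_cdf_psi [OF P])
  show "psi m (uniform_product_cdf m w) \<in> {0<..<1}"
    by (rule psi_mem [OF P])
qed (rule assms)

lemma psi_one: "u \<in> {0<..<1} \<Longrightarrow> psi 1 u = u"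
  using uniform_product_cdf_psi [of u 1] by (simp add: uniform_product_cdf_def)

lemma DERIV_psi:
  assumes u: "u \<in> {0<..<1}"
  shows "(psi m has_real_derivative inverse (uniform_product_density m (psi m u))) (at u)"
proof -
  define w where "w = psi m u"
  have w: "w \<in> {0<..<1}" and P: "uniform_product_cdf m w = u"
    using psi_mem uniform_product_cdf_psi u by (auto simp: w_def)
  have "isCont (psi m) (uniform_product_cdf m w)"
  proof (rule isCont_inverse_function [where f = "uniform_product_cdf m" and x = w])
    show "0 < min w (1 - w) / 2" using w by simp
    fix z assume "\<bar>z - w\<bar> \<le> min w (1 - w) / 2"
    then have z: "z \<in> {0<..<1}" using w by (auto simp: abs_if min_def split: if_splits)
    show "psi m (uniform_product_cdf m z) = z" by (rule psi_uniform_product_cdf [OF z])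
    show "isCont (uniform_product_cdf m) z"
      using DERIV_isCont [OF DERIV_uniform_product_cdf] z by simp
  qed
  then have cont: "isCont (psi m) u"
    by (simp only: P)
  show ?thesis
  proof (rule DERIV_inverse_function)
    show "(uniform_product_cdf m has_real_derivative uniform_product_density m (psi m u)) (at (psi m u))"
      using w by (intro DERIV_uniform_product_cdf) (simp add: w_def)
    show "uniform_product_density m (psi m u) \<noteq> 0"
      using uniform_product_density_pos [OF w, of m] by (simp add: w_def)
    show "0 < u" "u < 1"
      using u by simp_all
    show "uniform_product_cdf m (psi m v) = v" if "0 < v" "v < 1" for v
      using that by (intro uniform_product_cdf_psi) simp
  qed (rule cont)
qed

text \<open>
  Off the unit interval \<open>psi m\<close> is the constant \<open>undefined\<close>, which does no harm to measurability.
\<close>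

lemma measurable_psi [measurable]: "psi m \<in> borel_measurable borel"
proof -
  have "continuous_on {0<..<1} (psi m)"
    by (intro continuous_at_imp_continuous_on ballI DERIV_isCont [OF DERIV_psi])
  then have "(\<lambda>u. if u \<in> {0<..<1} then psi m u else undefined) \<in> borel_measurable borel"
    by (intro borel_measurable_continuous_on_if) auto
  also have "(\<lambda>u. if u \<in> {0<..<1} then psi m u else undefined) = psi m"
  proof -
    have "psi m \<in> {0<..<1} \<rightarrow>\<^sub>E {0<..<1}"
      using is_psi_psi [of m] unfolding is_psi_iff by blast
    then show ?thesis by (intro ext) (simp add: PiE_arb [of "psi m"])
  qed
  finally show ?thesis .
qed

section \<open>The chain of partial products of uniform variables\<close>

text \<open>
  For \<open>0 < v < 1\<close>, this is the density of \<open>v * V\<close> with respect to the uniform distribution, for a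
  uniform variable \<open>V\<close>. The product \<open>shrink_chain K\<close> of such kernels is therefore the joint density of the partial products
  \<open>V\<^sub>1, V\<^sub>1 * V\<^sub>2, \<dots>, V\<^sub>1 * \<dots> * V\<^sub>K\<close> with respect to the uniform distribution on the cube.
\<close>

definition shrink_kernel :: "real \<Rightarrow> real \<Rightarrow> ennreal" where
  "shrink_kernel v s = (if s < v then ennreal (1 / v) else 0)"

definition shrink_chain :: "nat \<Rightarrow> (nat \<Rightarrow> real) \<Rightarrow> ennreal" where
  "shrink_chain K w = (\<Prod>j\<in>{1..<K}. shrink_kernel (w j) (w (Suc j)))"

abbreviation uniform_cube :: "nat \<Rightarrow> (nat \<Rightarrow> real) measure" where
  "uniform_cube K \<equiv> PiM {1..K} (\<lambda>_. uniform01)"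

lemma measurable_shrink_kernel [measurable (raw)]:
  assumes [measurable]: "f \<in> borel_measurable M" "g \<in> borel_measurable M"
  shows "(\<lambda>x. shrink_kernel (f x) (g x)) \<in> borel_measurable M"
  unfolding shrink_kernel_def by measurable

lemma measurable_shrink_chain [measurable]:
  "shrink_chain K \<in> borel_measurable (uniform_cube K)"
  unfolding shrink_chain_def [abs_def]
  by (intro borel_measurable_prod_ennreal measurable_shrink_kernel) measurable

lemma nn_integral_shrink_kernel:
  assumes "v \<in> {0<..<1}"
  shows "(\<integral>\<^sup>+s. shrink_kernel v s \<partial>uniform01) = 1"
proof -
  have "(\<integral>\<^sup>+s. shrink_kernel v s \<partial>uniform01) = (\<integral>\<^sup>+s. ennreal (1 / v) * indicator {..<v} s \<partial>uniform01)"
    by (intro nn_integral_cong) (simp add: shrink_kernel_def)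
  also have "\<dots> = ennreal (1 / v) * emeasure uniform01 {..<v}"
    by (rule nn_integral_cmult_indicator) simp
  also have "{..<v} \<inter> {0<..<1} = {0<..<v}"
    using assms by auto
  then have "emeasure uniform01 {..<v} = ennreal v"
    using assms by (simp add: emeasure_uniform01)
  finally show ?thesis
    using assms by (simp flip: ennreal_mult)
qed

text \<open>
  Multiplying by one more uniform factor turns the density for \<open>n\<close> factors into that for \<open>Suc n\<close>:
  an antiderivative of \<open>(- ln v) ^ (n - 1) / (v * fact (n - 1))\<close> is \<open>- (- ln v) ^ n / fact n\<close>.
\<close>

lemma nn_integral_shrink_kernel_density:
  assumes s: "s \<in> {0<..<1}" and "1 \<le> n"
  shows "(\<integral>\<^sup>+v. shrink_kernel v s * ennreal (uniform_product_density n v) \<partial>uniform01)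
    = ennreal (uniform_product_density (Suc n) s)"
proof -
  obtain k where n: "n = Suc k" using \<open>1 \<le> n\<close> by (cases n) auto
  let ?f = "\<lambda>v::real. 1 / v * uniform_product_density n v"
  let ?F = "\<lambda>v::real. - ((- ln v) ^ Suc k / fact (Suc k))"
  have "(\<integral>\<^sup>+v. shrink_kernel v s * ennreal (uniform_product_density n v) \<partial>uniform01)
      = (\<integral>\<^sup>+v. shrink_kernel v s * ennreal (uniform_product_density n v) * indicator {0<..<1} v \<partial>lborel)"
    by (rule nn_integral_uniform01) measurable
  \<comment> \<open>The two integrands differ at most at the end points \<open>s\<close> and \<open>1\<close>.\<close>
  also have "\<dots> = (\<integral>\<^sup>+v. ennreal (?f v) * indicator {s..1} v \<partial>lborel)"
  proof (rule nn_integral_cong_AE)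
    have "AE v in lborel. v \<noteq> s \<and> v \<noteq> (1::real)"
      using AE_lborel_singleton by (intro AE_conjI)
    then show "AE v in lborel. shrink_kernel v s * ennreal (uniform_product_density n v) * indicator {0<..<1} v
        = ennreal (?f v) * indicator {s..1} v"
    proof eventually_elim
      case (elim v)
      then show ?case
        using s uniform_product_density_pos [of v n]
        by (auto simp: shrink_kernel_def indicator_def simp flip: ennreal_mult)
    qed
  qed
  also have "\<dots> = ?F 1 - ?F s"
  proof (rule nn_integral_FTC_Icc)
    show "?f \<in> borel_measurable borel" by measurable
    fix v assume v: "v \<in> {s..1}"
    then have "v > 0" using s by simp
    then show "(?F has_real_derivative ?f v) (at v)"
    proof -
      have "((\<lambda>v. - ln v) has_real_derivative - (1 / v)) (at v)"
        using \<open>v > 0\<close> by (auto intro!: derivative_eq_intros)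
      from DERIV_minus [OF DERIV_cdivide [OF DERIV_power [OF this, of "Suc k"], of "fact (Suc k)"]]
      show ?thesis
        by (simp add: n uniform_product_density_def divide_simps del: power_Suc of_nat_Suc)
    qed
    show "0 \<le> ?f v"
      using v \<open>v > 0\<close> by (simp add: uniform_product_density_def)
  qed (use s in simp)
  also have "?F 1 - ?F s = uniform_product_density (Suc n) s"
    by (simp add: n uniform_product_density_def)
  finally show ?thesis .
qed

lemma nn_integral_shrink_chain_Suc:
  assumes "1 \<le> K" and [measurable]: "G \<in> borel_measurable (uniform_cube (Suc K))"
  shows "(\<integral>\<^sup>+w. shrink_chain (Suc K) w * G w \<partial>uniform_cube (Suc K))
    = (\<integral>\<^sup>+w. shrink_chain K w * (\<integral>\<^sup>+s. shrink_kernel (w K) s * G (w(Suc K := s)) \<partial>uniform01) \<partial>uniform_cube K)"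
proof -
  interpret product_sigma_finite "\<lambda>_::nat. uniform01" by (rule product_sigma_finite_uniform01)
  have ins: "insert (Suc K) {1..K} = {1..Suc K}"
    by auto
  have K [measurable]: "K \<in> {1..K}" using \<open>1 \<le> K\<close> by simp
  have "(\<integral>\<^sup>+w. shrink_chain (Suc K) w * G w \<partial>uniform_cube (Suc K))
      = (\<integral>\<^sup>+w. \<integral>\<^sup>+s. shrink_chain (Suc K) (w(Suc K := s)) * G (w(Suc K := s)) \<partial>uniform01 \<partial>uniform_cube K)"
    by (subst ins [symmetric], subst product_nn_integral_insert) (simp_all add: ins del: One_nat_def)
  also have "\<dots> = (\<integral>\<^sup>+w. shrink_chain K w * (\<integral>\<^sup>+s. shrink_kernel (w K) s * G (w(Suc K := s)) \<partial>uniform01) \<partial>uniform_cube K)"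
  proof (rule nn_integral_cong)
    fix w assume w: "w \<in> space (uniform_cube K)"
    have [measurable]: "(\<lambda>s. G (w(Suc K := s))) \<in> borel_measurable uniform01"
      using measurable_comp [OF measurable_component_update [OF w], of "Suc K" G borel] by (simp add: ins comp_def del: One_nat_def)
    have "shrink_chain (Suc K) (w(Suc K := s)) = shrink_chain K w * shrink_kernel (w K) s" for s
    proof -
      have "(\<Prod>j\<in>{1..<K}. shrink_kernel ((w(Suc K := s)) j) ((w(Suc K := s)) (Suc j))) = shrink_chain K w"
        unfolding shrink_chain_def by (intro prod.cong) auto
      moreover have "{1..<Suc K} = insert K {1..<K}"
        using \<open>1 \<le> K\<close> by auto
      ultimately show ?thesis
        unfolding shrink_chain_def by (simp add: mult.commute)
    qed
    then show "(\<integral>\<^sup>+s. shrink_chain (Suc K) (w(Suc K := s)) * G (w(Suc K := s)) \<partial>uniform01)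
        = shrink_chain K w * (\<integral>\<^sup>+s. shrink_kernel (w K) s * G (w(Suc K := s)) \<partial>uniform01)"
      by (simp add: mult.assoc nn_integral_cmult)
  qed
  finally show ?thesis .
qed

text \<open>
  By induction: integrating out the last coordinate, interchanging the two remaining integrals and
  applying \<open>nn_integral_shrink_kernel_density\<close> adds one factor.
\<close>

lemma nn_integral_shrink_chain_last:
  assumes "1 \<le> K" and "f \<in> borel_measurable borel"
  shows "(\<integral>\<^sup>+w. shrink_chain K w * f (w K) \<partial>uniform_cube K)
    = (\<integral>\<^sup>+t. f t * ennreal (uniform_product_density K t) \<partial>uniform01)"
  using assms
proof (induction K arbitrary: f rule: dec_induct)
  case base
  interpret product_sigma_finite "\<lambda>_::nat. uniform01" by (rule product_sigma_finite_uniform01)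
  show ?case
    using base product_nn_integral_singleton [of f 1]
    by (simp add: shrink_chain_def uniform_product_density_def)
next
  case (step K)
  note [measurable] = \<open>f \<in> borel_measurable borel\<close>
  let ?g = "\<lambda>v. \<integral>\<^sup>+s. shrink_kernel v s * f s \<partial>uniform01"
  interpret U: sigma_finite_measure uniform01
    by (intro prob_space_imp_sigma_finite prob_space_uniform01)
  interpret UU: pair_sigma_finite uniform01 uniform01 ..
  have [measurable]: "?g \<in> borel_measurable borel"
    by measurable
  have "(\<integral>\<^sup>+w. shrink_chain (Suc K) w * f (w (Suc K)) \<partial>uniform_cube (Suc K))
      = (\<integral>\<^sup>+w. shrink_chain K w * ?g (w K) \<partial>uniform_cube K)"
    using step by (subst nn_integral_shrink_chain_Suc) auto
  also have "\<dots> = (\<integral>\<^sup>+v. ?g v * ennreal (uniform_product_density K v) \<partial>uniform01)"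
    by (rule step.IH) measurable
  also have "\<dots> = (\<integral>\<^sup>+v. \<integral>\<^sup>+s. f s * (shrink_kernel v s * ennreal (uniform_product_density K v)) \<partial>uniform01 \<partial>uniform01)"
    by (intro nn_integral_cong, subst nn_integral_multc [symmetric]) (simp_all add: mult_ac)
  also have "\<dots> = (\<integral>\<^sup>+s. \<integral>\<^sup>+v. f s * (shrink_kernel v s * ennreal (uniform_product_density K v)) \<partial>uniform01 \<partial>uniform01)"
    by (rule UU.Fubini') measurable
  also have "\<dots> = (\<integral>\<^sup>+s. f s * ennreal (uniform_product_density (Suc K) s) \<partial>uniform01)"
  proof (rule nn_integral_cong_AE, use AE_uniform01 in eventually_elim)
    case (elim s)
    show ?case
      using nn_integral_shrink_kernel_density [OF elim \<open>1 \<le> K\<close>] by (simp add: nn_integral_cmult)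
  qed
  finally show ?case .
qed

text \<open>
  Coordinates after the \<open>m\<close>-th integrate to \<open>1\<close>, since each kernel is a probability density, and so
  the \<open>m\<close>-th marginal of a longer chain is that of the chain of length \<open>m\<close>.
\<close>

lemma nn_integral_shrink_chain_component:
  assumes "1 \<le> m" "m \<le> K" and f [measurable]: "f \<in> borel_measurable borel"
  shows "(\<integral>\<^sup>+w. shrink_chain K w * f (w m) \<partial>uniform_cube K)
    = (\<integral>\<^sup>+t. f t * ennreal (uniform_product_density m t) \<partial>uniform01)"
  using \<open>m \<le> K\<close>
proof (induction K rule: dec_induct)
  case base
  show ?case by (rule nn_integral_shrink_chain_last) fact+
next
  case (step K)
  have m: "m \<in> {1..Suc K}" and K: "K \<in> {1..K}" using step \<open>1 \<le> m\<close> by auto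
  note [measurable] = measurable_compose [OF measurable_component_singleton [OF m] f]
  have "(\<integral>\<^sup>+w. shrink_chain (Suc K) w * f (w m) \<partial>uniform_cube (Suc K))
      = (\<integral>\<^sup>+w. shrink_chain K w * (\<integral>\<^sup>+s. shrink_kernel (w K) s * f (w m) \<partial>uniform01) \<partial>uniform_cube K)"
    using step \<open>1 \<le> m\<close> by (subst nn_integral_shrink_chain_Suc) auto
  also have "\<dots> = (\<integral>\<^sup>+w. shrink_chain K w * f (w m) \<partial>uniform_cube K)"
  proof (rule nn_integral_cong_AE)
    have "AE w in uniform_cube K. w K \<in> {0<..<1}"
      by (rule AE_PiM_component [OF prob_space_uniform01 K AE_uniform01])
    then show "AE w in uniform_cube K. shrink_chain K w * (\<integral>\<^sup>+s. shrink_kernel (w K) s * f (w m) \<partial>uniform01)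
        = shrink_chain K w * f (w m)"
      by eventually_elim (simp add: nn_integral_multc nn_integral_shrink_kernel)
  qed
  finally show ?case using step by simp
qed

section \<open>The MGEV distribution in uniform coordinates\<close>

definition mgev_domain :: "real \<Rightarrow> real \<Rightarrow> real \<Rightarrow> real set" where
  "mgev_domain \<mu> \<sigma> \<xi> = {z. \<xi> = 0 \<or> -1 < \<xi> * ((z - \<mu>) / \<sigma>)}"

definition mgev_Lambda_deriv :: "real \<Rightarrow> real \<Rightarrow> real \<Rightarrow> real \<Rightarrow> real" where
  "mgev_Lambda_deriv \<mu> \<sigma> \<xi> z =
     - (if \<xi> = 0 then exp (- ((z - \<mu>) / \<sigma>)) else (1 + \<xi> * ((z - \<mu>) / \<sigma>)) powr (- 1 / \<xi> - 1)) / \<sigma>"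

text \<open>
  The first marginal distribution function of the MGEV distribution, used as a coordinate on
  \<open>mgev_domain\<close>.
\<close>

definition mgev_unif :: "real \<Rightarrow> real \<Rightarrow> real \<Rightarrow> real \<Rightarrow> real" where
  "mgev_unif \<mu> \<sigma> \<xi> z = exp (- mgev_Lambda \<mu> \<sigma> \<xi> z)"

definition mgev_unif_deriv :: "real \<Rightarrow> real \<Rightarrow> real \<Rightarrow> real \<Rightarrow> real" where
  "mgev_unif_deriv \<mu> \<sigma> \<xi> z = mgev_unif \<mu> \<sigma> \<xi> z * - mgev_Lambda_deriv \<mu> \<sigma> \<xi> z"

context
  fixes \<mu> \<sigma> \<xi> :: real
  assumes \<sigma>: "0 < \<sigma>"
begin

lemma mgev_domain_iff:
  "z \<in> mgev_domain \<mu> \<sigma> \<xi> \<longleftrightarrow> (0 < \<xi> \<longrightarrow> \<mu> - \<sigma> / \<xi> < z) \<and> (\<xi> < 0 \<longrightarrow> z < \<mu> - \<sigma> / \<xi>)"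
  using \<sigma> by (cases "\<xi> = 0"; cases "0 < \<xi>") (auto simp: mgev_domain_def field_simps)

lemma mgev_domain_borel [measurable]: "mgev_domain \<mu> \<sigma> \<xi> \<in> sets borel"
  unfolding mgev_domain_def by measurable

lemma measurable_mgev_unif [measurable]: "mgev_unif \<mu> \<sigma> \<xi> \<in> borel_measurable borel"
  unfolding mgev_unif_def [abs_def] mgev_Lambda_def by measurable

lemma measurable_mgev_unif_deriv [measurable]: "mgev_unif_deriv \<mu> \<sigma> \<xi> \<in> borel_measurable borel"
  unfolding mgev_unif_deriv_def [abs_def] mgev_Lambda_deriv_def by measurable

lemma DERIV_mgev_Lambda:
  assumes "z \<in> mgev_domain \<mu> \<sigma> \<xi>"
  shows "(mgev_Lambda \<mu> \<sigma> \<xi> has_real_derivative mgev_Lambda_deriv \<mu> \<sigma> \<xi> z) (at z)"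
proof (cases "\<xi> = 0")
  case True
  then show ?thesis
    using \<sigma> by (auto simp: mgev_Lambda_def [abs_def] mgev_Lambda_deriv_def intro!: derivative_eq_intros)
next
  case False
  then have "0 < 1 + \<xi> * ((z - \<mu>) / \<sigma>)"
    using assms by (simp add: mgev_domain_def)
  then have "((\<lambda>z. (1 + \<xi> * ((z - \<mu>) / \<sigma>)) powr (- 1 / \<xi>)) has_real_derivative
      - 1 / \<xi> * (1 + \<xi> * ((z - \<mu>) / \<sigma>)) powr (- 1 / \<xi> - 1) * (\<xi> * (1 / \<sigma>))) (at z)"
    using \<sigma> by (auto intro!: derivative_eq_intros DERIV_powr simp: powr_diff)
  then show ?thesis
    using False by (simp add: mgev_Lambda_def [abs_def] mgev_Lambda_deriv_def)
qed

lemma mgev_Lambda_deriv_neg: "z \<in> mgev_domain \<mu> \<sigma> \<xi> \<Longrightarrow> mgev_Lambda_deriv \<mu> \<sigma> \<xi> z < 0"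
  using \<sigma> by (auto simp: mgev_Lambda_deriv_def mgev_domain_def)

lemma DERIV_mgev_unif:
  "z \<in> mgev_domain \<mu> \<sigma> \<xi> \<Longrightarrow>
    (mgev_unif \<mu> \<sigma> \<xi> has_real_derivative mgev_unif_deriv \<mu> \<sigma> \<xi> z) (at z)"
  unfolding mgev_unif_def [abs_def] mgev_unif_deriv_def
  by (auto intro!: derivative_eq_intros DERIV_mgev_Lambda)

lemma mgev_unif_deriv_pos: "z \<in> mgev_domain \<mu> \<sigma> \<xi> \<Longrightarrow> 0 < mgev_unif_deriv \<mu> \<sigma> \<xi> z"
  using mgev_Lambda_deriv_neg by (simp add: mgev_unif_deriv_def mgev_unif_def mult_pos_neg)

lemma mgev_unif_strict_mono: "strict_mono_on (mgev_domain \<mu> \<sigma> \<xi>) (mgev_unif \<mu> \<sigma> \<xi>)"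
proof (rule strict_mono_onI)
  fix y z assume yz: "y \<in> mgev_domain \<mu> \<sigma> \<xi>" "z \<in> mgev_domain \<mu> \<sigma> \<xi>" "y < z"
  show "mgev_unif \<mu> \<sigma> \<xi> y < mgev_unif \<mu> \<sigma> \<xi> z"
  proof (rule DERIV_pos_imp_increasing [OF \<open>y < z\<close>])
    fix x assume "y \<le> x" "x \<le> z"
    then have "x \<in> mgev_domain \<mu> \<sigma> \<xi>"
      using yz by (auto simp: mgev_domain_iff)
    then show "\<exists>d. (mgev_unif \<mu> \<sigma> \<xi> has_real_derivative d) (at x) \<and> 0 < d"
      using DERIV_mgev_unif mgev_unif_deriv_pos by blast
  qed
qed

lemma mgev_unif_less_iff:
  "y \<in> mgev_domain \<mu> \<sigma> \<xi> \<Longrightarrow> z \<in> mgev_domain \<mu> \<sigma> \<xi> \<Longrightarrow>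
    mgev_unif \<mu> \<sigma> \<xi> y < mgev_unif \<mu> \<sigma> \<xi> z \<longleftrightarrow> y < z"
  using strict_mono_on_less [OF mgev_unif_strict_mono] by blast

lemma bij_betw_mgev_unif: "bij_betw (mgev_unif \<mu> \<sigma> \<xi>) (mgev_domain \<mu> \<sigma> \<xi>) {0<..<1}"
proof (rule bij_betw_imageI)
  show "inj_on (mgev_unif \<mu> \<sigma> \<xi>) (mgev_domain \<mu> \<sigma> \<xi>)"
    by (rule strict_mono_on_imp_inj_on [OF mgev_unif_strict_mono])
  show "mgev_unif \<mu> \<sigma> \<xi> ` mgev_domain \<mu> \<sigma> \<xi> = {0<..<1}"
  proof (intro equalityI subsetI)
    fix w assume "w \<in> mgev_unif \<mu> \<sigma> \<xi> ` mgev_domain \<mu> \<sigma> \<xi>"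
    then show "w \<in> {0<..<1}"
      by (auto simp: mgev_unif_def mgev_Lambda_def mgev_domain_def)
  next
    fix w :: real assume w: "w \<in> {0<..<1}"
    define t where "t = - ln w"
    have t: "0 < t" "exp (- t) = w" using w by (simp_all add: t_def)
    \<comment> \<open>The solution of \<open>\<Lambda>(z) = t\<close>.\<close>
    define z where "z = \<mu> + \<sigma> * (if \<xi> = 0 then - ln t else (t powr (- \<xi>) - 1) / \<xi>)"
    have "z \<in> mgev_domain \<mu> \<sigma> \<xi>" "mgev_Lambda \<mu> \<sigma> \<xi> z = t"
      using \<sigma> t by (auto simp: z_def mgev_domain_def mgev_Lambda_def powr_powr)
    then show "w \<in> mgev_unif \<mu> \<sigma> \<xi> ` mgev_domain \<mu> \<sigma> \<xi>"
      using t by (auto simp: mgev_unif_def intro!: image_eqI [of _ _ z])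
  qed
qed

lemma mgev_unif_mem: "z \<in> mgev_domain \<mu> \<sigma> \<xi> \<Longrightarrow> mgev_unif \<mu> \<sigma> \<xi> z \<in> {0<..<1}"
  by (rule bij_betw_apply [OF bij_betw_mgev_unif])

text \<open>
  The support bounds only its first or last coordinate, but the ordering spreads this bound to all of
  them.
\<close>

lemma mgev_support_iff:
  assumes "1 \<le> K"
  shows "z \<in> mgev_support K \<mu> \<sigma> \<xi> \<longleftrightarrow>
    (\<forall>j\<in>{1..<K}. z (Suc j) < z j) \<and> (\<forall>j\<in>{1..K}. z j \<in> mgev_domain \<mu> \<sigma> \<xi>)"
proof -
  have le: "z k \<le> z j" if ord: "\<forall>j\<in>{1..<K}. z (Suc j) < z j" and "1 \<le> j" "j \<le> k" "k \<le> K" for j k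
    using \<open>j \<le> k\<close> \<open>k \<le> K\<close>
  proof (induction k rule: dec_induct)
    case (step n)
    then have "z (Suc n) < z n" using ord \<open>1 \<le> j\<close> by simp
    then show ?case using step by simp
  qed simp
  show ?thesis
    unfolding mgev_support_def mgev_domain_iff
    using assms le [of _ K] le [of 1] by (fastforce intro: less_le_trans le_less_trans)
qed

text \<open>
  With \<open>w = exp (- \<Lambda>)\<close> one has \<open>- \<Lambda>' = w' / w\<close>. Hence the density \<open>exp (- \<Lambda>(z\<^sub>K)) * \<Prod>(- \<Lambda>'(z\<^sub>j))\<close> is the product
  of all the \<open>w'\<close>, which the coordinate change absorbs, and of \<open>1 / w\<close> at every coordinate except the
  last, where it cancels against \<open>exp (- \<Lambda>(z\<^sub>K))\<close>.
\<close>

lemma ennreal_mgev_density: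
  assumes "1 \<le> K"
  shows "ennreal (mgev_density K \<mu> \<sigma> \<xi> z) =
    (\<Prod>j\<in>{1..K}. indicator (mgev_domain \<mu> \<sigma> \<xi>) (z j) * ennreal (mgev_unif_deriv \<mu> \<sigma> \<xi> (z j))) *
    shrink_chain K (\<lambda>j\<in>{1..K}. mgev_unif \<mu> \<sigma> \<xi> (z j))"
proof (cases "\<forall>j\<in>{1..K}. z j \<in> mgev_domain \<mu> \<sigma> \<xi>")
  case False
  then have "z \<notin> mgev_support K \<mu> \<sigma> \<xi>"
    using mgev_support_iff [OF assms] by blast
  moreover have "(\<Prod>j\<in>{1..K}. indicator (mgev_domain \<mu> \<sigma> \<xi>) (z j) * ennreal (mgev_unif_deriv \<mu> \<sigma> \<xi> (z j))) = 0"
  proof -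
    obtain j where "j \<in> {1..K}" "z j \<notin> mgev_domain \<mu> \<sigma> \<xi>" using False by blast
    then show ?thesis by (intro prod_zero bexI [of _ j]) auto
  qed
  ultimately show ?thesis
    by (simp add: mgev_density_def)
next
  case dom: True
  let ?W = "\<lambda>j. mgev_unif \<mu> \<sigma> \<xi> (z j)" and ?L = "\<lambda>j. mgev_Lambda_deriv \<mu> \<sigma> \<xi> (z j)"
  have W: "0 < ?W j" for j by (simp add: mgev_unif_def)
  have L: "?L j < 0" if "j \<in> {1..K}" for j
    using that dom mgev_Lambda_deriv_neg by blast
  have K: "{1..K} = insert K {1..<K}"
    using assms by auto
  show ?thesis
  proof (cases "\<forall>j\<in>{1..<K}. z (Suc j) < z j")
    case True
    then have z: "z \<in> mgev_support K \<mu> \<sigma> \<xi>"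
      using mgev_support_iff [OF assms] dom by blast
    have "shrink_chain K (\<lambda>j\<in>{1..K}. ?W j) = (\<Prod>j\<in>{1..<K}. ennreal (1 / ?W j))"
      unfolding shrink_chain_def
      using True dom by (intro prod.cong) (auto simp: shrink_kernel_def mgev_unif_less_iff)
    moreover have "(\<Prod>j\<in>{1..K}. indicator (mgev_domain \<mu> \<sigma> \<xi>) (z j) * ennreal (mgev_unif_deriv \<mu> \<sigma> \<xi> (z j)))
        = (\<Prod>j\<in>{1..K}. ennreal (?W j * - ?L j))"
      using dom by (intro prod.cong) (auto simp: mgev_unif_deriv_def)
    moreover have "(\<Prod>j\<in>{1..K}. ennreal (?W j * - ?L j)) * (\<Prod>j\<in>{1..<K}. ennreal (1 / ?W j))
        = ennreal ((\<Prod>j\<in>{1..K}. ?W j * - ?L j) * (\<Prod>j\<in>{1..<K}. 1 / ?W j))"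
    proof -
      have "0 \<le> ?W j * - ?L j" if "j \<in> {1..K}" for j
        using W [of j] L [OF that] by (intro mult_nonneg_nonneg) simp_all
      moreover have "0 \<le> 1 / ?W j" for j
        using W [of j] by simp
      ultimately show ?thesis
        by (simp only: prod_ennreal ennreal_mult prod_nonneg)
    qed
    moreover have "(\<Prod>j\<in>{1..K}. ?W j * - ?L j) * (\<Prod>j\<in>{1..<K}. 1 / ?W j) = ?W K * (\<Prod>j\<in>{1..K}. - ?L j)"
    proof -
      have "(\<Prod>j\<in>{1..<K}. ?W j) * (\<Prod>j\<in>{1..<K}. 1 / ?W j) = 1"
        using W by (simp add: less_imp_neq [symmetric] flip: prod.distrib)
      moreover have "(\<Prod>j\<in>{1..K}. ?W j) = ?W K * (\<Prod>j\<in>{1..<K}. ?W j)"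
        unfolding K by simp
      ultimately show ?thesis
        by (simp only: prod.distrib) (simp add: mult.assoc mult.left_commute)
    qed
    moreover have "mgev_density K \<mu> \<sigma> \<xi> z = ?W K * (\<Prod>j\<in>{1..K}. - ?L j)"
    proof -
      have "(\<Prod>j=1..K. deriv (mgev_Lambda \<mu> \<sigma> \<xi>) (z j)) = (\<Prod>j=1..K. ?L j)"
        using dom by (intro prod.cong refl DERIV_imp_deriv DERIV_mgev_Lambda) auto
      then show ?thesis
        using z by (simp add: mgev_density_def mgev_unif_def prod_uminus)
    qed
    ultimately show ?thesis by simp
  next
    case False
    then obtain j where j: "j \<in> {1..<K}" "\<not> z (Suc j) < z j" by blast
    then have "shrink_kernel (?W j) (?W (Suc j)) = 0"
      using dom by (auto simp: shrink_kernel_def mgev_unif_less_iff)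
    then have "shrink_chain K (\<lambda>j\<in>{1..K}. ?W j) = 0"
      unfolding shrink_chain_def using j by (intro prod_zero bexI [of _ j]) auto
    moreover have "z \<notin> mgev_support K \<mu> \<sigma> \<xi>"
      using False mgev_support_iff [OF assms] by blast
    ultimately show ?thesis by (simp add: mgev_density_def)
  qed
qed

lemma distr_density_mgev_unif:
  "distr (density lborel (\<lambda>z. indicator (mgev_domain \<mu> \<sigma> \<xi>) z * ennreal (mgev_unif_deriv \<mu> \<sigma> \<xi> z)))
    uniform01 (mgev_unif \<mu> \<sigma> \<xi>) = uniform01"
  using bij_betw_mgev_unif DERIV_mgev_unif mgev_unif_deriv_pos
  by (intro distr_derivative_uniform01) (auto simp: less_imp_le)

text \<open>
  The parameters have disappeared from the right-hand side, which is why the copula does not depend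
  on them.
\<close>

lemma distr_mgev:
  assumes "1 \<le> K"
  shows "distr (mgev K \<mu> \<sigma> \<xi>) (uniform_cube K) (\<lambda>z. \<lambda>j\<in>{1..K}. mgev_unif \<mu> \<sigma> \<xi> (z j))
    = density (uniform_cube K) (shrink_chain K)"
  unfolding mgev_def ennreal_mgev_density [OF assms]
  by (rule distr_density_PiM [OF product_sigma_finite_lborel product_sigma_finite_uniform01])
    (simp_all add: distr_density_mgev_unif del: One_nat_def)

lemma sets_mgev [measurable_cong]: "sets (mgev K \<mu> \<sigma> \<xi>) = sets (PiM {1..K} (\<lambda>_. borel))"
  unfolding mgev_def by (simp cong: sets_PiM_cong)

lemma measurable_mgev_component:
  "j \<in> {1..K} \<Longrightarrow> (\<lambda>z. z j) \<in> borel_measurable (mgev K \<mu> \<sigma> \<xi>)"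
  unfolding measurable_cong_sets [OF sets_mgev refl] by (rule measurable_component_singleton)

lemma measurable_mgev_unif_vector:
  "(\<lambda>z. \<lambda>j\<in>{1..K}. mgev_unif \<mu> \<sigma> \<xi> (z j)) \<in> mgev K \<mu> \<sigma> \<xi> \<rightarrow>\<^sub>M uniform_cube K"
  by measurable

lemma nn_integral_mgev_component:
  assumes "1 \<le> m" "m \<le> K" and f [measurable]: "f \<in> borel_measurable borel"
  shows "(\<integral>\<^sup>+z. f (mgev_unif \<mu> \<sigma> \<xi> (z m)) \<partial>mgev K \<mu> \<sigma> \<xi>)
    = (\<integral>\<^sup>+w. f w * ennreal (uniform_product_density m w) \<partial>uniform01)"
proof -
  have m [measurable]: "m \<in> {1..K}" using assms by simp
  have "(\<integral>\<^sup>+z. f (mgev_unif \<mu> \<sigma> \<xi> (z m)) \<partial>mgev K \<mu> \<sigma> \<xi>)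
      = (\<integral>\<^sup>+w. f (w m) \<partial>distr (mgev K \<mu> \<sigma> \<xi>) (uniform_cube K) (\<lambda>z. \<lambda>j\<in>{1..K}. mgev_unif \<mu> \<sigma> \<xi> (z j)))"
    using m by (subst nn_integral_distr) (simp_all del: One_nat_def)
  also have "\<dots> = (\<integral>\<^sup>+w. shrink_chain K w * f (w m) \<partial>uniform_cube K)"
    using assms by (subst distr_mgev) (simp_all add: nn_integral_density del: One_nat_def)
  finally show ?thesis
    by (simp only: nn_integral_shrink_chain_component [OF assms])
qed

text \<open>
  The probability integral transform for a product of \<open>m\<close> uniform variables, in the form used to
  evaluate marginal distribution functions.
\<close>

lemma nn_integral_uniform_product:
  assumes [measurable]: "g \<in> borel_measurable borel"
  shows "(\<integral>\<^sup>+w. g (uniform_product_cdf m w) * ennreal (uniform_product_density m w) \<partial>uniform01)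
    = (\<integral>\<^sup>+u. g u \<partial>uniform01)"
proof -
  have "(\<integral>\<^sup>+u. g u \<partial>uniform01) = (\<integral>\<^sup>+u. g u \<partial>distr
      (density uniform01 (\<lambda>w. ennreal (uniform_product_density m w))) uniform01 (uniform_product_cdf m))"
    by (simp only: distr_uniform_product_cdf)
  also have "\<dots> = (\<integral>\<^sup>+w. g (uniform_product_cdf m w)
      \<partial>density uniform01 (\<lambda>w. ennreal (uniform_product_density m w)))"
    by (rule nn_integral_distr) simp_all
  also have "\<dots> = (\<integral>\<^sup>+w. ennreal (uniform_product_density m w) * g (uniform_product_cdf m w) \<partial>uniform01)"
    by (rule nn_integral_density) measurable
  finally show ?thesis
    by (simp add: mult.commute)
qed

lemma prob_space_mgev:
  assumes "1 \<le> K"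
  shows "prob_space (mgev K \<mu> \<sigma> \<xi>)"
proof
  have "emeasure (mgev K \<mu> \<sigma> \<xi>) (space (mgev K \<mu> \<sigma> \<xi>))
      = (\<integral>\<^sup>+z. (\<lambda>_. 1) (mgev_unif \<mu> \<sigma> \<xi> (z 1)) \<partial>mgev K \<mu> \<sigma> \<xi>)"
    by simp
  also have "\<dots> = (\<integral>\<^sup>+w. (\<lambda>_. 1) (uniform_product_cdf 1 w) * ennreal (uniform_product_density 1 w) \<partial>uniform01)"
    using assms by (subst nn_integral_mgev_component) auto
  also have "\<dots> = 1"
    by (subst nn_integral_uniform_product) (simp_all add: prob_space.emeasure_space_1 [OF prob_space_uniform01, simplified])
  finally show "emeasure (mgev K \<mu> \<sigma> \<xi>) (space (mgev K \<mu> \<sigma> \<xi>)) = 1" .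
qed

text \<open>
  The formula for \<open>mgev_unif\<close> has a meaning on \<open>mgev_domain\<close> only, so that every computation with the
  marginals starts by discarding the complement.
\<close>

lemma AE_mgev_domain:
  assumes "1 \<le> K"
  shows "AE z in mgev K \<mu> \<sigma> \<xi>. \<forall>j\<in>{1..K}. z j \<in> mgev_domain \<mu> \<sigma> \<xi>"
proof -
  have meas: "(\<lambda>z. ennreal (mgev_density K \<mu> \<sigma> \<xi> z)) \<in> borel_measurable (PiM {1..K} (\<lambda>_. lborel))"
    unfolding ennreal_mgev_density [OF assms]
    by (intro borel_measurable_times_ennreal borel_measurable_prod_ennreal
        measurable_compose [OF _ measurable_shrink_chain]) measurable
  have "\<forall>j\<in>{1..K}. z j \<in> mgev_domain \<mu> \<sigma> \<xi>" if "0 < ennreal (mgev_density K \<mu> \<sigma> \<xi> z)" for z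
  proof -
    have "z \<in> mgev_support K \<mu> \<sigma> \<xi>"
      using that by (rule contrapos_pp) (simp add: mgev_density_def)
    then show ?thesis
      unfolding mgev_support_iff [OF assms] by blast
  qed
  then show ?thesis
    unfolding mgev_def AE_density [OF meas] by blast
qed

text \<open>
  As \<open>mgev_unif\<close> is increasing, the \<open>m\<close>-th coordinate is at most \<open>t\<close> with the probability that a
  product of \<open>m\<close> uniform variables is at most \<open>mgev_unif t\<close>.
\<close>

lemma marginal_cdf_mgev:
  assumes m: "1 \<le> m" "m \<le> K" and t: "t \<in> mgev_domain \<mu> \<sigma> \<xi>"
  shows "marginal_cdf (mgev K \<mu> \<sigma> \<xi>) m t = uniform_product_cdf m (mgev_unif \<mu> \<sigma> \<xi> t)"
proof -
  have m' [measurable]: "m \<in> {1..K}" using m by simp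
  define w where "w = mgev_unif \<mu> \<sigma> \<xi> t"
  define u where "u = uniform_product_cdf m w"
  have w: "w \<in> {0<..<1}" and u: "u \<in> {0<..<1}"
    using mgev_unif_mem [OF t] uniform_product_cdf_mem by (auto simp: w_def u_def)
  have "emeasure (distr (mgev K \<mu> \<sigma> \<xi>) borel (\<lambda>z. z m)) {..t}
      = (\<integral>\<^sup>+z. indicator {..t} (z m) \<partial>mgev K \<mu> \<sigma> \<xi>)"
    by (subst nn_integral_indicator [symmetric], simp, subst nn_integral_distr)
      (auto intro: measurable_mgev_component m')
  also have "\<dots> = (\<integral>\<^sup>+z. indicator {..w} (mgev_unif \<mu> \<sigma> \<xi> (z m)) \<partial>mgev K \<mu> \<sigma> \<xi>)"
  proof (rule nn_integral_cong_AE)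
    have "1 \<le> K" using m by simp
    from AE_mgev_domain [OF this]
    show "AE z in mgev K \<mu> \<sigma> \<xi>. indicator {..t} (z m) = (indicator {..w} (mgev_unif \<mu> \<sigma> \<xi> (z m)) :: ennreal)"
    proof eventually_elim
      case (elim z)
      then show ?case
        using mgev_unif_less_iff [OF t, of "z m"] m' by (auto simp: indicator_def w_def not_less [symmetric])
    qed
  qed
  also have "\<dots> = (\<integral>\<^sup>+v. indicator {..w} v * ennreal (uniform_product_density m v) \<partial>uniform01)"
    using m by (intro nn_integral_mgev_component) auto
  also have "\<dots> = (\<integral>\<^sup>+v. indicator {..u} (uniform_product_cdf m v) * ennreal (uniform_product_density m v) \<partial>uniform01)"
  proof (rule nn_integral_cong_AE, use AE_uniform01 in eventually_elim)
    case (elim v)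
    then show ?case
      using w strict_mono_on_less_eq [OF uniform_product_cdf_strict_mono [of m], of v w]
      by (auto simp: indicator_def u_def)
  qed
  also have "\<dots> = (\<integral>\<^sup>+v. indicator {..u} v \<partial>uniform01)"
    by (rule nn_integral_uniform_product) measurable
  also have "\<dots> = ennreal u"
  proof -
    have "{..u} \<inter> {0<..<1} = {0<..u}" using u by auto
    then show ?thesis using u by (simp add: emeasure_uniform01)
  qed
  finally show ?thesis
    using u by (simp add: marginal_cdf_def cdf_def measure_def u_def w_def)
qed

end

section \<open>The copula density\<close>

text \<open>
  Since \<open>psi 1\<close> is the identity, the first inequality of the region has the same form as the others.
\<close>

lemma mgev_copula_region_iff:
  assumes "2 \<le> K"
  shows "u \<in> mgev_copula_region K \<longleftrightarrow> u \<in> {1..K} \<rightarrow>\<^sub>E {0<..<1} \<and>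
    (\<forall>j\<in>{1..<K}. psi (Suc j) (u (Suc j)) < psi j (u j))"
proof -
  have "{1..<K} = insert 1 {2..<K}"
    using assms by auto
  moreover have "psi 1 (u 1) = u 1" if "u \<in> {1..K} \<rightarrow>\<^sub>E {0<..<1}"
    using PiE_mem [OF that, of 1] assms by (intro psi_one) auto
  ultimately show ?thesis
    by (auto simp: mgev_copula_region_def numeral_2_eq_2)
qed

lemma mgev_copula_density_eq:
  assumes "2 \<le> K" and u: "u \<in> mgev_copula_region K"
  shows "mgev_copula_density K u =
    inverse (\<Prod>j\<in>{1..<K}. psi j (u j) * uniform_product_density j (psi j (u j))) *
    inverse (uniform_product_density K (psi K (u K)))"
proof -
  have u01: "u j \<in> {0<..<1}" if "j \<in> {1..K}" for j
    using u that unfolding mgev_copula_region_def by (blast dest: PiE_mem)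
  have "deriv (\<lambda>t. ln (psi j t)) (u j) = inverse (psi j (u j) * uniform_product_density j (psi j (u j)))"
    if "j \<in> {1..K}" for j
  proof (rule DERIV_imp_deriv)
    have "0 < psi j (u j)"
      using psi_mem [OF u01 [OF that], of j] by simp
    from DERIV_chain2 [OF DERIV_ln [OF this] DERIV_psi [OF u01 [OF that]]]
    show "((\<lambda>t. ln (psi j t)) has_real_derivative
        inverse (psi j (u j) * uniform_product_density j (psi j (u j)))) (at (u j))"
      by (simp add: field_simps)
  qed
  moreover have "deriv (psi K) (u K) = inverse (uniform_product_density K (psi K (u K)))"
    using assms(1) by (intro DERIV_imp_deriv DERIV_psi u01) simp
  moreover have "{1..K-1} = {1..<K}"
    using assms(1) by auto
  ultimately have "mgev_copula_density K u =
      (\<Prod>j\<in>{1..<K}. inverse (psi j (u j) * uniform_product_density j (psi j (u j)))) *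
      inverse (uniform_product_density K (psi K (u K)))"
    using u by (simp add: mgev_copula_density_def)
  then show ?thesis
    by (simp only: prod_inversef [symmetric] comp_def)
qed

lemma mgev_copula_density_nonneg:
  assumes "2 \<le> K"
  shows "0 \<le> mgev_copula_density K u"
proof (cases "u \<in> mgev_copula_region K")
  case True
  then have "psi j (u j) \<in> {0<..<1}" if "j \<in> {1..K}" for j
    using that unfolding mgev_copula_region_def by (blast dest: PiE_mem intro: psi_mem)
  then have "0 < psi j (u j)" "0 < uniform_product_density j (psi j (u j))" if "j \<in> {1..K}" for j
    using that uniform_product_density_pos by auto
  then show ?thesis
    using assms unfolding mgev_copula_density_eq [OF assms True]
    by (intro mult_nonneg_nonneg inverse_nonnegative_iff_nonnegative [THEN iffD2] prod_nonneg ballI)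
      (auto simp: less_imp_le)
qed (simp add: mgev_copula_density_def)

lemma measurable_mgev_copula_density:
  assumes "2 \<le> K"
  shows "mgev_copula_density K \<in> borel_measurable (PiM {1..K} (\<lambda>_. borel))"
proof -
  let ?R = "\<lambda>u. (\<forall>j\<in>{1..K}. u j \<in> {0<..<1}) \<and> (\<forall>j\<in>{1..<K}. psi (Suc j) (u (Suc j)) < psi j (u j))"
  let ?f = "\<lambda>u. if ?R u then
    inverse (\<Prod>j\<in>{1..<K}. psi j (u j) * uniform_product_density j (psi j (u j))) *
    inverse (uniform_product_density K (psi K (u K))) else 0"
  have [measurable]: "K \<in> {1..K}" using assms by simp
  have "?f \<in> borel_measurable (PiM {1..K} (\<lambda>_. borel))"
    by measurable
  also have "?this \<longleftrightarrow> ?thesis"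
  proof (rule measurable_cong)
    fix u :: "nat \<Rightarrow> real" assume "u \<in> space (PiM {1..K} (\<lambda>_. borel))"
    then have "?R u \<longleftrightarrow> u \<in> mgev_copula_region K"
      unfolding mgev_copula_region_iff [OF assms] by (simp add: space_PiM PiE_iff)
    then show "?f u = mgev_copula_density K u"
      using mgev_copula_density_eq [OF assms, of u] by (simp add: mgev_copula_density_def)
  qed
  finally show ?thesis .
qed

text \<open>
  At \<open>u = P(w)\<close>, with \<open>P\<^sub>j\<close> and \<open>p\<^sub>j\<close> the distribution function and density of a product of \<open>j\<close>
  uniform variables, the inequalities \<open>psi (j + 1) (u\<^sub>j\<^sub>+\<^sub>1) < psi j (u\<^sub>j)\<close> become \<open>w\<^sub>j\<^sub>+\<^sub>1 < w\<^sub>j\<close>, and the copula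
  density becomes the chain density divided by the Jacobian \<open>\<Prod>p\<^sub>j(w\<^sub>j)\<close>.
\<close>

lemma distr_shrink_chain:
  assumes "2 \<le> K"
  shows "distr (density (uniform_cube K) (shrink_chain K)) (uniform_cube K)
      (\<lambda>w. \<lambda>j\<in>{1..K}. uniform_product_cdf j (w j))
    = density (uniform_cube K) (\<lambda>u. ennreal (mgev_copula_density K u))"
proof -
  let ?p = uniform_product_density
  let ?P = "\<lambda>w. \<lambda>j\<in>{1..K}. uniform_product_cdf j (w j)"
  have c [measurable]: "(\<lambda>u. ennreal (mgev_copula_density K u)) \<in> borel_measurable (uniform_cube K)"
    using measurable_mgev_copula_density [OF assms]
    by (simp add: measurable_cong_sets [OF sets_PiM_cong [OF refl sets_uniform01] refl])
  have "density (uniform_cube K) (shrink_chain K) = density (uniform_cube K)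
      (\<lambda>w. (\<Prod>j\<in>{1..K}. ennreal (?p j (w j))) * ennreal (mgev_copula_density K (?P w)))"
  proof (rule density_cong)
    show "(\<lambda>w. (\<Prod>j\<in>{1..K}. ennreal (?p j (w j))) * ennreal (mgev_copula_density K (?P w)))
        \<in> borel_measurable (uniform_cube K)"
      by (intro borel_measurable_times_ennreal borel_measurable_prod_ennreal
          measurable_compose [OF _ c]) measurable
    have "AE w in uniform_cube K. \<forall>j\<in>{1..K}. w j \<in> {0<..<1}"
      by (intro AE_finite_allI AE_PiM_component [OF prob_space_uniform01 _ AE_uniform01]) simp_all
    then show "AE w in uniform_cube K. shrink_chain K w
        = (\<Prod>j\<in>{1..K}. ennreal (?p j (w j))) * ennreal (mgev_copula_density K (?P w))"
    proof eventually_elim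
      case w: (elim w)
      have psi_P: "psi j (?P w j) = w j" if "j \<in> {1..K}" for j
        using w that by (simp add: psi_uniform_product_cdf)
      have region: "?P w \<in> mgev_copula_region K \<longleftrightarrow> (\<forall>j\<in>{1..<K}. w (Suc j) < w j)"
        unfolding mgev_copula_region_iff [OF assms]
        using w uniform_product_cdf_mem psi_P by (auto simp del: restrict_apply)
      show ?case
      proof (cases "\<forall>j\<in>{1..<K}. w (Suc j) < w j")
        case True
        have "shrink_chain K w = (\<Prod>j\<in>{1..<K}. ennreal (1 / w j))"
          unfolding shrink_chain_def using True by (intro prod.cong) (auto simp: shrink_kernel_def)
        also have "\<dots> = ennreal (\<Prod>j\<in>{1..<K}. 1 / w j)"
          using w by (intro prod_ennreal) (auto simp: less_imp_le)
        also have "(\<Prod>j\<in>{1..<K}. 1 / w j) = (\<Prod>j\<in>{1..K}. ?p j (w j)) * mgev_copula_density K (?P w)"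
        proof -
          have p: "?p j (w j) \<noteq> 0" if "j \<in> {1..K}" for j
            using w that uniform_product_density_pos [of "w j" j] by auto
          have density: "mgev_copula_density K (?P w)
              = inverse (\<Prod>j\<in>{1..<K}. w j * ?p j (w j)) * inverse (?p K (w K))"
            unfolding mgev_copula_density_eq [OF assms region [THEN iffD2, OF True]]
            using psi_P assms by (auto intro!: arg_cong2 [of _ _ _ _ "(*)"] arg_cong [of _ _ inverse] prod.cong simp del: restrict_apply)
          have split: "(\<Prod>j\<in>{1..K}. ?p j (w j)) = ?p K (w K) * (\<Prod>j\<in>{1..<K}. ?p j (w j))"
          proof -
            have "{1..K} = insert K {1..<K}" using assms by auto
            then show ?thesis by simp
          qed
          have nonzero: "?p K (w K) \<noteq> 0" "(\<Prod>j\<in>{1..<K}. ?p j (w j)) \<noteq> 0"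
            using p assms by auto
          have cancel: "1 / a = (q * b) * (inverse (a * b) * inverse q)" if "q \<noteq> 0" "b \<noteq> 0" for a b q :: real
            using that by (simp add: field_simps)
          show ?thesis
            unfolding density split prod.distrib prod_dividef prod.neutral_const
            using nonzero by (rule cancel)
        qed
        also have "ennreal \<dots> = (\<Prod>j\<in>{1..K}. ennreal (?p j (w j))) * ennreal (mgev_copula_density K (?P w))"
        proof -
          have "0 \<le> ?p j (w j)" if "j \<in> {1..K}" for j
            using w that uniform_product_density_pos [of "w j" j] by auto
          then show ?thesis
            by (simp only: prod_ennreal ennreal_mult prod_nonneg mgev_copula_density_nonneg [OF assms])
        qed
        finally show ?thesis .
      next
        case False
        then obtain j where "j \<in> {1..<K}" "\<not> w (Suc j) < w j" by blast
        then have "shrink_chain K w = 0"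
          unfolding shrink_chain_def by (intro prod_zero bexI [of _ j]) (auto simp: shrink_kernel_def)
        moreover have "mgev_copula_density K (?P w) = 0"
        proof -
          have "?P w \<notin> mgev_copula_region K"
            using False region by blast
          then show ?thesis
            by (simp only: mgev_copula_density_def if_False)
        qed
        ultimately show ?thesis
          by simp
      qed
    qed
  qed measurable
  then show ?thesis
    using distr_density_PiM [OF product_sigma_finite_uniform01 product_sigma_finite_uniform01 _ _ _ _ c,
        where H = uniform_product_cdf and h = "\<lambda>j w. ennreal (?p j w)"]
    by (simp add: distr_uniform_product_cdf del: One_nat_def)
qed

text \<open>
  The identity map is used as a transport from Lebesgue measure to the uniform distribution, with the
  indicator of the unit interval as density.
\<close>

lemma density_uniform_cube_eq_distr_lborel:
  assumes "c \<in> borel_measurable (uniform_cube K)"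
  shows "density (uniform_cube K) c = distr (density (PiM {1..K} (\<lambda>_. lborel))
      (\<lambda>u. (\<Prod>j\<in>{1..K}. indicator {0<..<1} (u j)) * c (\<lambda>j\<in>{1..K}. u j)))
    (uniform_cube K) (\<lambda>u. \<lambda>j\<in>{1..K}. u j)"
proof -
  have "distr (density lborel (indicator {0<..<1})) uniform01 (\<lambda>u. u) = uniform01"
    unfolding uniform01_def by (rule distr_id2) simp
  then show ?thesis
    using assms
    by (intro distr_density_PiM [OF product_sigma_finite_lborel product_sigma_finite_uniform01, symmetric,
          where H = "\<lambda>_ u. u" and h = "\<lambda>_. indicator {0<..<1}"]) simp_all
qed

lemma distr_mgev_copula:
  assumes "2 \<le> K" and "0 < \<sigma>"
  shows "distr (mgev K \<mu> \<sigma> \<xi>) (uniform_cube K)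
      (\<lambda>z. \<lambda>j\<in>{1..K}. uniform_product_cdf j (mgev_unif \<mu> \<sigma> \<xi> (z j)))
    = density (uniform_cube K) (\<lambda>u. ennreal (mgev_copula_density K u))"
proof -
  let ?P = "\<lambda>w. \<lambda>j\<in>{1..K}. uniform_product_cdf j (w j)"
  let ?W = "\<lambda>z. \<lambda>j\<in>{1..K}. mgev_unif \<mu> \<sigma> \<xi> (z j)"
  have P: "?P \<in> uniform_cube K \<rightarrow>\<^sub>M uniform_cube K"
    by measurable
  have "distr (distr (mgev K \<mu> \<sigma> \<xi>) (uniform_cube K) ?W) (uniform_cube K) ?P
      = density (uniform_cube K) (\<lambda>u. ennreal (mgev_copula_density K u))"
    using assms by (subst distr_mgev) (simp_all add: distr_shrink_chain del: One_nat_def)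
  also have "distr (distr (mgev K \<mu> \<sigma> \<xi>) (uniform_cube K) ?W) (uniform_cube K) ?P
      = distr (mgev K \<mu> \<sigma> \<xi>) (uniform_cube K) (?P \<circ> ?W)"
    by (rule distr_distr [OF P measurable_mgev_unif_vector [OF \<open>0 < \<sigma>\<close>]])
  also have "?P \<circ> ?W = (\<lambda>z. \<lambda>j\<in>{1..K}. uniform_product_cdf j (mgev_unif \<mu> \<sigma> \<xi> (z j)))"
    by (auto simp: fun_eq_iff)
  finally show ?thesis .
qed

text \<open>
  The explicit formula for the marginal distribution functions is available on \<open>mgev_domain\<close>, which is
  enough since the MGEV distribution lives there. Measurability of the event on the left-hand side
  comes from the monotonicity of \<open>marginal_cdf\<close>.
\<close>

lemma emeasure_mgev_marginal_cdf_le: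
  assumes "2 \<le> K" and "0 < \<sigma>"
  shows "emeasure (mgev K \<mu> \<sigma> \<xi>)
      {z \<in> space (mgev K \<mu> \<sigma> \<xi>). \<forall>j\<in>{1..K}. marginal_cdf (mgev K \<mu> \<sigma> \<xi>) j (z j) \<le> u j}
    = emeasure (density (uniform_cube K) (\<lambda>u. ennreal (mgev_copula_density K u)))
        {x \<in> space (uniform_cube K). \<forall>j\<in>{1..K}. x j \<le> u j}"
proof -
  let ?M = "mgev K \<mu> \<sigma> \<xi>"
  let ?V = "\<lambda>z. \<lambda>j\<in>{1..K}. uniform_product_cdf j (mgev_unif \<mu> \<sigma> \<xi> (z j))"
  have "1 \<le> K" using assms by simp
  interpret prob_space ?M by (rule prob_space_mgev [OF \<open>0 < \<sigma>\<close> \<open>1 \<le> K\<close>])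
  note comp = measurable_mgev_component [OF \<open>0 < \<sigma>\<close>, of _ K \<mu> \<xi>]
  have cdf [measurable]: "marginal_cdf ?M j \<in> borel_measurable borel" if "j \<in> {1..K}" for j
  proof (rule borel_measurable_mono)
    interpret D: real_distribution "distr ?M borel (\<lambda>z. z j)"
      by (rule real_distribution_distr [OF comp [OF that]])
    show "mono (marginal_cdf ?M j)"
      unfolding marginal_cdf_def by (intro monoI D.cdf_nondecreasing)
  qed
  have V [measurable]: "?V \<in> ?M \<rightarrow>\<^sub>M uniform_cube K"
    by (intro measurable_restrict measurable_compose [OF measurable_compose
          [OF comp measurable_mgev_unif [OF \<open>0 < \<sigma>\<close>]]])
      simp_all
  have box [measurable]: "{x \<in> space (uniform_cube K). \<forall>j\<in>{1..K}. x j \<le> u j} \<in> sets (uniform_cube K)"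
    by measurable
  have "emeasure ?M {z \<in> space ?M. \<forall>j\<in>{1..K}. marginal_cdf ?M j (z j) \<le> u j}
      = emeasure ?M (?V -` {x \<in> space (uniform_cube K). \<forall>j\<in>{1..K}. x j \<le> u j} \<inter> space ?M)"
  proof (rule emeasure_eq_AE)
    show "AE z in ?M. z \<in> {z \<in> space ?M. \<forall>j\<in>{1..K}. marginal_cdf ?M j (z j) \<le> u j} \<longleftrightarrow>
        z \<in> ?V -` {x \<in> space (uniform_cube K). \<forall>j\<in>{1..K}. x j \<le> u j} \<inter> space ?M"
      using AE_mgev_domain [OF \<open>0 < \<sigma>\<close> \<open>1 \<le> K\<close>]
    proof eventually_elim
      case (elim z)
      then show ?case
        by (auto simp: marginal_cdf_mgev [OF \<open>0 < \<sigma>\<close>] space_PiM)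
    qed
    show "{z \<in> space ?M. \<forall>j\<in>{1..K}. marginal_cdf ?M j (z j) \<le> u j} \<in> events"
      by (intro sets.sets_Collect_finite_All' borel_measurable_le measurable_compose [OF comp cdf])
        (use \<open>1 \<le> K\<close> in auto)
  qed measurable
  also have "\<dots> = emeasure (distr ?M (uniform_cube K) ?V) {x \<in> space (uniform_cube K). \<forall>j\<in>{1..K}. x j \<le> u j}"
    by (rule emeasure_distr [symmetric]) measurable
  finally show ?thesis
    unfolding distr_mgev_copula [OF assms] .
qed

lemma has_copula_density_mgev:
  assumes "2 \<le> K" and "0 < \<sigma>"
  shows "has_copula_density {1..K} (copula {1..K} (mgev K \<mu> \<sigma> \<xi>)) (mgev_copula_density K)"
  unfolding has_copula_density_def
proof (intro conjI ballI)
  let ?c = "\<lambda>u. ennreal (mgev_copula_density K u)" and ?L = "PiM {1..K} (\<lambda>_. lborel) :: (nat \<Rightarrow> real) measure"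
  show "mgev_copula_density K \<in> borel_measurable ?L"
    using measurable_mgev_copula_density [OF \<open>2 \<le> K\<close>]
    by (simp add: measurable_cong_sets [OF sets_PiM_cong [OF refl sets_lborel] refl])
  show "0 \<le> mgev_copula_density K x" for x
    by (rule mgev_copula_density_nonneg [OF \<open>2 \<le> K\<close>])
  have c [measurable]: "?c \<in> borel_measurable (uniform_cube K)"
    using measurable_mgev_copula_density [OF assms(1)]
    by (simp add: measurable_cong_sets [OF sets_PiM_cong [OF refl sets_uniform01] refl])
  fix u :: "nat \<Rightarrow> real" assume "u \<in> {1..K} \<rightarrow>\<^sub>E {0..1}"
  let ?B = "{x \<in> space (uniform_cube K). \<forall>j\<in>{1..K}. x j \<le> u j}"
  interpret prob_space "mgev K \<mu> \<sigma> \<xi>" using assms by (intro prob_space_mgev) simp_all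
  have B [measurable]: "?B \<in> sets (uniform_cube K)"
    by measurable
  have "ennreal (copula {1..K} (mgev K \<mu> \<sigma> \<xi>) u) = emeasure (density (uniform_cube K) ?c) ?B"
    unfolding copula_def emeasure_eq_measure [symmetric] by (rule emeasure_mgev_marginal_cdf_le [OF assms])
  also have "\<dots> = (\<integral>\<^sup>+x. ((\<Prod>j\<in>{1..K}. indicator {0<..<1} (x j)) * ?c (\<lambda>j\<in>{1..K}. x j)) *
      indicator ?B (\<lambda>j\<in>{1..K}. x j) \<partial>?L)"
    unfolding density_uniform_cube_eq_distr_lborel [OF c]
    by (intro emeasure_distr_density borel_measurable_times_ennreal borel_measurable_prod_ennreal
          measurable_compose [OF _ c] B) measurable
  also have "\<dots> = (\<integral>\<^sup>+x \<in> (\<Pi>\<^sub>E j\<in>{1..K}. {0..u j}). ?c x \<partial>?L)"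
  proof (rule nn_integral_cong)
    fix x assume "x \<in> space ?L"
    then have x: "x \<in> extensional {1..K}" "(\<lambda>j\<in>{1..K}. x j) = x"
      by (auto simp: space_PiM PiE_def extensional_restrict)
    show "((\<Prod>j\<in>{1..K}. indicator {0<..<1} (x j)) * ?c (\<lambda>j\<in>{1..K}. x j)) * indicator ?B (\<lambda>j\<in>{1..K}. x j)
        = ?c x * indicator (\<Pi>\<^sub>E j\<in>{1..K}. {0..u j}) x"
    \<comment> \<open>The copula density vanishes off the open cube, and on it only the upper ends of the box matter.\<close>
    proof (cases "x \<in> mgev_copula_region K")
      case True
      then have x01: "x j \<in> {0<..<1}" if "j \<in> {1..K}" for j
        using that unfolding mgev_copula_region_def by (blast dest: PiE_mem)
      then have "(\<Prod>j\<in>{1..K}. indicator {0<..<1} (x j) :: ennreal) = 1"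
        by (intro prod.neutral) simp
      moreover have "x \<in> ?B \<longleftrightarrow> x \<in> (\<Pi>\<^sub>E j\<in>{1..K}. {0..u j})"
        using x x01 by (auto simp: space_PiM PiE_iff less_imp_le)
      ultimately show ?thesis
        unfolding x(2) by (simp add: indicator_def)
    next
      case False
      then show ?thesis unfolding x(2) by (simp add: mgev_copula_density_def)
    qed
  qed
  finally show "ennreal (copula {1..K} (mgev K \<mu> \<sigma> \<xi>) u)
      = (\<integral>\<^sup>+x \<in> (\<Pi>\<^sub>E j\<in>{1..K}. {0..u j}). ?c x \<partial>?L)" .
qed

theorem proposition2p2:
  fixes K :: nat and \<mu> \<sigma> \<xi> :: real
  assumes "K \<ge> 2" and "\<sigma> > 0"
  shows "(\<forall>m\<ge>1. (\<exists>!f. is_psi m f) \<and> (\<forall>t\<in>{0<..<1}. psi m field_differentiable at t)) \<and>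
    has_copula_density {1..K} (copula {1..K} (mgev K \<mu> \<sigma> \<xi>)) (mgev_copula_density K) \<and>
    (\<forall>u\<in>mgev_copula_region K.
       mgev_copula_density K u =
         inverse (\<Prod>j=1..K-1. (-1) ^ (j - 1) * psi j (u j) * ((ln (psi j (u j))) ^ (j - 1) / fact (j - 1))) *
         inverse ((- ln (psi K (u K))) ^ (K - 1) / fact (K - 1)))"
proof (intro conjI allI impI ballI)
  show "\<exists>!f. is_psi m f" for m
    by (rule ex1_is_psi)
  show "psi m field_differentiable at t" if "t \<in> {0<..<1}" for m t
    using DERIV_psi [OF that] unfolding field_differentiable_def by blast
  show "has_copula_density {1..K} (copula {1..K} (mgev K \<mu> \<sigma> \<xi>)) (mgev_copula_density K)"
    by (rule has_copula_density_mgev [OF assms])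
  fix u assume "u \<in> mgev_copula_region K"
  note density_eq = mgev_copula_density_eq [OF assms(1) this]
  have "psi j (u j) * uniform_product_density j (psi j (u j))
      = (-1) ^ (j - 1) * psi j (u j) * ((ln (psi j (u j))) ^ (j - 1) / fact (j - 1))" for j
    by (simp add: uniform_product_density_def power_minus [of "ln _"])
  moreover have "{1..<K} = {1..K-1}"
    using assms(1) by auto
  ultimately show "mgev_copula_density K u =
      inverse (\<Prod>j=1..K-1. (-1) ^ (j - 1) * psi j (u j) * ((ln (psi j (u j))) ^ (j - 1) / fact (j - 1))) *
      inverse ((- ln (psi K (u K))) ^ (K - 1) / fact (K - 1))"
    unfolding density_eq by (simp only: uniform_product_density_def)
qed

end
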